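(* Let $n>1$ be an integer, let $B$ be the open unit ball in $\mathbb{R}^n$, and let $\Omega\subset\mathbb{R}^n$ be a domain with $C^{1,\alpha}$ boundary, where $\alpha\in(0,1]$. Let $f:B\to\mathbb{R}^n$ be a harmonic mapping with $f(B)=\Omega$ that is quasiconformal as a mapping $B\to\Omega$ (that is, $K$-quasiconformal for some $K\ge 1$). Then $f$ is Lipschitz continuous in $B$, i.e. there is a constant $L<\infty$ such that $|f(x)-f(y)|\le L|x-y|$ for all $x,y\in B$.
   Context: $|\cdot|$ denotes the Euclidean norm on $\mathbb{R}^n$ and $B=\{x\in\mathbb{R}^n:|x|<1\}$. A mapping $f=(f_1,\ldots,f_n):U\to\mathbb{R}^n$ on a domain $U\subset\mathbb{R}^n$ is harmonic if each $f_j$ is a real harmonic function, i.e. satisfies $\Delta f_j=\sum_{i=1}^n D_{ii}f_j=0$ in $U$. A homeomorphism $f:U\to V$ between domains $U,V\subset\mathbb{R}^n$ is $K$-quasiconformal ($K\ge 1$) if $f$ is absolutely continuous on lines (i.e. absolutely continuous on almost every segment in $U$ parallel to a coordinate axis, with partial derivatives that are locally $L^n$-integrable in $U$) and $|\nabla f(x)|\le K\,l(\nabla f(x))$ for all $x\in U$, where $|\nabla f(x)|=\sup\{|f'(x)h|:|h|=1\}$ and $l(\nabla f(x))=\inf\{|f'(x)h|:|h|=1\}$. A function $\Phi$ on a set $U\subset\mathbb{R}^n$ is $\mu$-Hölder continuous, $\Phi\in C^\mu(U)$, if $\sup_{x,y\in U,\,x\ne y}|\Phi(x)-\Phi(y)|/|x-y|^\mu<\infty$;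 and $\Phi\in C^{1,\mu}(U)$ if $\Phi\in C^1(U)$ and $\nabla\Phi\in C^\mu(U)$; similarly for vector-valued mappings. A domain $\Omega\subset\mathbb{R}^n$ has $C^{1,\alpha}$ boundary (written $\partial\Omega\in C^{1,\alpha}$) if there is a $C^{1,\alpha}$ diffeomorphism $G:\overline{B}\to\overline{\Omega}$.
   Formalization: The C^{1,α} diffeomorphism G from the closed ball onto the closure of Ω is also required to map B onto Ω; without this a slit disc counts as having smooth boundary, and the conformal map onto it is harmonic and quasiconformal but not Lipschitz. *)

theory Defs
  imports "HOL-Analysis.Analysis"
begin

definition domain :: "'a::topological_space set \<Rightarrow> bool"
  where "domain U \<longleftrightarrow> open U \<and> connected U \<and> U \<noteq> {}"

definition partial_derivative ::
    "'n \<Rightarrow> (real^'n \<Rightarrow> 'b::real_normed_vector) \<Rightarrow> real^'n \<Rightarrow> 'b"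
  where "partial_derivative i f x = vector_derivative (\<lambda>t. f (x + t *\<^sub>R axis i 1)) (at 0)"

text \<open>Derivatives are taken within \<open>U\<close>, so that \<open>C1_on\<close> and \<open>C1_Holder_on\<close> make sense
  both on open sets and on closures of domains.\<close>

definition C1_on ::
    "'a::real_normed_vector set \<Rightarrow> ('a \<Rightarrow> 'b::real_normed_vector) \<Rightarrow> bool"
  where "C1_on U f \<longleftrightarrow>
    (\<exists>f' :: 'a \<Rightarrow> 'a \<Rightarrow>\<^sub>L 'b.
       (\<forall>x\<in>U. (f has_derivative blinfun_apply (f' x)) (at x within U)) \<and> continuous_on U f')"

definition Holder_on ::
    "real \<Rightarrow> 'a::metric_space set \<Rightarrow> ('a \<Rightarrow> 'b::metric_space) \<Rightarrow> bool"
  where "Holder_on \<mu> U \<Phi> \<longleftrightarrow>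
    (\<exists>C. \<forall>x\<in>U. \<forall>y\<in>U. dist (\<Phi> x) (\<Phi> y) \<le> C * dist x y powr \<mu>)"

definition C1_Holder_on ::
    "real \<Rightarrow> 'a::real_normed_vector set \<Rightarrow> ('a \<Rightarrow> 'b::real_normed_vector) \<Rightarrow> bool"
  where "C1_Holder_on \<mu> U f \<longleftrightarrow>
    (\<exists>f' :: 'a \<Rightarrow> 'a \<Rightarrow>\<^sub>L 'b.
       (\<forall>x\<in>U. (f has_derivative blinfun_apply (f' x)) (at x within U)) \<and>
       continuous_on U f' \<and> Holder_on \<mu> U f')"

definition C1_Holder_diffeomorphism ::
    "real \<Rightarrow> 'a::real_normed_vector set \<Rightarrow> 'b::real_normed_vector set \<Rightarrow> ('a \<Rightarrow> 'b) \<Rightarrow> bool"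
  where "C1_Holder_diffeomorphism \<mu> S T G \<longleftrightarrow>
    (\<exists>H. homeomorphism S T G H \<and> C1_Holder_on \<mu> S G \<and> C1_Holder_on \<mu> T H)"

text \<open>The diffeomorphism is one of closed domains, i.e. it maps the open ball onto \<open>\<Omega>\<close> and hence
  the sphere onto the frontier. Without the last conjunct a slit ball, whose closure is the closed
  ball, would have smooth boundary.\<close>

definition C1_Holder_boundary :: "real \<Rightarrow> (real^'n) set \<Rightarrow> bool"
  where "C1_Holder_boundary \<alpha> \<Omega> \<longleftrightarrow>
    (\<exists>G :: real^'n \<Rightarrow> real^'n.
       C1_Holder_diffeomorphism \<alpha> (cball 0 1) (closure \<Omega>) G \<and> G ` ball 0 1 = \<Omega>)"

text \<open>Harmonic functions are, as usual, of class \<open>C\<^sup>2\<close>.\<close>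

definition harmonic_function_on :: "(real^'n) set \<Rightarrow> (real^'n \<Rightarrow> real) \<Rightarrow> bool"
  where "harmonic_function_on U u \<longleftrightarrow>
    C1_on U u \<and> (\<forall>i. C1_on U (partial_derivative i u)) \<and>
    (\<forall>x\<in>U. (\<Sum>i\<in>UNIV. partial_derivative i (partial_derivative i u) x) = 0)"

definition harmonic_mapping_on :: "(real^'n) set \<Rightarrow> (real^'n \<Rightarrow> real^'m) \<Rightarrow> bool"
  where "harmonic_mapping_on U f \<longleftrightarrow> (\<forall>j. harmonic_function_on U (\<lambda>x. f x $ j))"

text \<open>A set \<open>d\<close> with \<open>d division_of T\<close> is a finite set of non-overlapping nonempty compact
  intervals \<open>k\<close> = \<open>{Inf k..Sup k}\<close> with union \<open>T\<close>.\<close>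

definition absolutely_continuous_on :: "real \<Rightarrow> real \<Rightarrow> (real \<Rightarrow> 'b::metric_space) \<Rightarrow> bool"
  where "absolutely_continuous_on a b g \<longleftrightarrow>
    (\<forall>\<epsilon>>0. \<exists>\<delta>>0. \<forall>d T. d division_of T \<and> T \<subseteq> {a..b} \<and> (\<Sum>k\<in>d. Sup k - Inf k) < \<delta> \<longrightarrow>
       (\<Sum>k\<in>d. dist (g (Sup k)) (g (Inf k))) < \<epsilon>)"

definition locally_Lp_on ::
    "nat \<Rightarrow> 'a::euclidean_space set \<Rightarrow> ('a \<Rightarrow> 'b::euclidean_space) \<Rightarrow> bool"
  where "locally_Lp_on p U g \<longleftrightarrow>
    (\<forall>C. compact C \<and> C \<subseteq> U \<longrightarrow>
       g \<in> borel_measurable (lebesgue_on C) \<and>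
       integrable (lebesgue_on C) (\<lambda>x. norm (g x) ^ p))"

text \<open>The exceptional lines parallel to the \<open>i\<close>-th axis form a set of \<open>(n - 1)\<close>-dimensional measure
  zero. By Fubini this holds iff their union is a null set in \<open>n\<close>-space, which is what the almost
  everywhere quantifier over the base point \<open>x\<close> expresses.\<close>

definition ACL_on :: "(real^'n) set \<Rightarrow> (real^'n \<Rightarrow> real^'m) \<Rightarrow> bool"
  where "ACL_on U f \<longleftrightarrow>
    (\<forall>i. (AE x in lebesgue. \<forall>s t. s \<le> t \<and> (\<forall>r\<in>{s..t}. x + r *\<^sub>R axis i 1 \<in> U) \<longrightarrow>
            absolutely_continuous_on s t (\<lambda>r. f (x + r *\<^sub>R axis i 1))) \<and>
         locally_Lp_on CARD('n) U (partial_derivative i f))"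

text \<open>A general mapping of this class is differentiable only almost everywhere. The distortion
  inequality is imposed at every point of \<open>U\<close> where the derivative exists; for a differentiable
  (in particular, harmonic) mapping this is every point of \<open>U\<close>.\<close>

definition K_quasiconformal ::
    "real \<Rightarrow> (real^'n) set \<Rightarrow> (real^'n) set \<Rightarrow> (real^'n \<Rightarrow> real^'n) \<Rightarrow> bool"
  where "K_quasiconformal K U V f \<longleftrightarrow>
    K \<ge> 1 \<and> domain U \<and> domain V \<and> (\<exists>g. homeomorphism U V f g) \<and> ACL_on U f \<and>
    (\<forall>x\<in>U. \<forall>D. (f has_derivative D) (at x) \<longrightarrow>
       (SUP h\<in>sphere 0 1. norm (D h)) \<le> K * (INF h\<in>sphere 0 1. norm (D h)))"

end

theory Submission
  imports Defs
begin

text \<open>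
  For a boundary point \<open>z\<close> with inner normal direction \<open>\<tau>\<close> put \<open>t = \<tau> \<bullet> (y - z)\<close> and
  \<open>\<psi>(y) = t + A t\<^sup>\<beta> - C |y - z|\<^sup>\<beta>\<close> with \<open>\<beta> = 1 + \<alpha>\<close>, for \<open>t > 0\<close>. Near \<open>z\<close> it is negative on the
  frontier, which lies in \<open>t \<le> C\<^sub>0 |y - z|\<^sup>\<beta>\<close>. Quasiconformality gives
  \<open>|\<nabla>(\<tau> \<bullet> f)| \<ge> c |Df|\<close>, so for large \<open>A\<close> the convexity of \<open>t\<^sup>\<beta>\<close> beats the concave last term and
  \<open>\<psi> \<circ> f\<close> is subharmonic. Comparison with a multiple of \<open>1 - |x|\<^sup>2\<close> yields
  \<open>\<psi>(f(x)) \<le> M (1 - |x|\<^sup>2)\<close>, uniformly in \<open>z\<close>.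

  The gradient bound is of Bernstein type. Since \<open>\<Delta>(\<psi> \<circ> f)\<^sup>2 \<ge> 2 |\<nabla>(\<psi> \<circ> f)|\<^sup>2 \<ge> c |Df|\<^sup>2\<close>, on the
  ball of radius \<open>s = (1 - |x\<^sub>0|) / 2\<close> about \<open>x\<^sub>0\<close> the function
  \<open>(s\<^sup>2 - |x - x\<^sub>0|\<^sup>2)\<^sup>2 |D\<^sub>k f|\<^sup>2 + a s\<^sup>2 (\<psi> \<circ> f)\<^sup>2\<close> obeys the maximum principle for suitable \<open>a\<close>,
  even if it is maximised over \<open>z\<close> as well; on the sphere it is \<open>O(s\<^sup>4)\<close>, whence \<open>|D\<^sub>k f(x\<^sub>0)| = O(1)\<close>. A difference
  quotient replaces \<open>D\<^sub>k f\<close>, so that no regularity beyond \<open>C\<^sup>2\<close> enters.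
\<close>

subsection \<open>Second derivatives along the axes and the maximum principle\<close>

text \<open>The derivatives are carried as explicit functions so that the rules below compute
  Laplacians by composition. \<open>w1\<close> is followed along the axis line because it is
  differentiated once more; \<open>w2\<close> enters only at \<open>x\<close>.\<close>

definition axis_derivs2 ::
    "(real^'n \<Rightarrow> 'b::real_normed_vector) \<Rightarrow> ('n \<Rightarrow> real^'n \<Rightarrow> 'b) \<Rightarrow>
     ('n \<Rightarrow> real^'n \<Rightarrow> 'b) \<Rightarrow> real^'n \<Rightarrow> bool"
  where "axis_derivs2 w w1 w2 x \<longleftrightarrow>
    (\<forall>i. ((\<lambda>r. w (x + r *\<^sub>R axis i 1)) has_vector_derivative w1 i x) (at 0) \<and>
         ((\<lambda>r. w1 i (x + r *\<^sub>R axis i 1)) has_vector_derivative w2 i x) (at 0))"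

section \<open>Calculus rules for axis derivatives\<close>

lemma axis_derivs2_const: "axis_derivs2 (\<lambda>x. c) (\<lambda>i x. 0) (\<lambda>i x. 0) x"
  by (simp add: axis_derivs2_def)

lemma axis_derivs2_ident: "axis_derivs2 (\<lambda>x. x) (\<lambda>i x. axis i 1) (\<lambda>i x. 0) x"
  unfolding axis_derivs2_def by (auto intro!: derivative_eq_intros)

lemma axis_derivs2_add:
  assumes "axis_derivs2 u u1 u2 x" "axis_derivs2 v v1 v2 x"
  shows "axis_derivs2 (\<lambda>x. u x + v x) (\<lambda>i x. u1 i x + v1 i x) (\<lambda>i x. u2 i x + v2 i x) x"
  using assms unfolding axis_derivs2_def by (auto intro!: derivative_intros)

lemma axis_derivs2_diff:
  assumes "axis_derivs2 u u1 u2 x" "axis_derivs2 v v1 v2 x"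
  shows "axis_derivs2 (\<lambda>x. u x - v x) (\<lambda>i x. u1 i x - v1 i x) (\<lambda>i x. u2 i x - v2 i x) x"
  using assms unfolding axis_derivs2_def by (auto intro!: derivative_intros)

lemma axis_derivs2_bilinear:
  assumes B: "bounded_bilinear B"
    and u: "axis_derivs2 u u1 u2 x" and v: "axis_derivs2 v v1 v2 x"
  shows "axis_derivs2 (\<lambda>x. B (u x) (v x)) (\<lambda>i x. B (u1 i x) (v x) + B (u x) (v1 i x))
           (\<lambda>i x. B (u2 i x) (v x) + 2 *\<^sub>R B (u1 i x) (v1 i x) + B (u x) (v2 i x)) x"
proof -
  note vd = bounded_bilinear.has_vector_derivative[OF B]
  have "((\<lambda>r. B (u (x + r *\<^sub>R axis i 1)) (v (x + r *\<^sub>R axis i 1)))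
          has_vector_derivative B (u1 i x) (v x) + B (u x) (v1 i x)) (at 0)" for i
    using u v vd[of "\<lambda>r. u (x + r *\<^sub>R axis i 1)" "u1 i x" 0 UNIV "\<lambda>r. v (x + r *\<^sub>R axis i 1)" "v1 i x"]
    by (simp add: axis_derivs2_def add.commute)
  moreover have "((\<lambda>r. B (u1 i (x + r *\<^sub>R axis i 1)) (v (x + r *\<^sub>R axis i 1)))
          has_vector_derivative B (u2 i x) (v x) + B (u1 i x) (v1 i x)) (at 0)" for i
    using u v vd[of "\<lambda>r. u1 i (x + r *\<^sub>R axis i 1)" "u2 i x" 0 UNIV "\<lambda>r. v (x + r *\<^sub>R axis i 1)" "v1 i x"]
    by (simp add: axis_derivs2_def add.commute)
  moreover have "((\<lambda>r. B (u (x + r *\<^sub>R axis i 1)) (v1 i (x + r *\<^sub>R axis i 1)))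
          has_vector_derivative B (u1 i x) (v1 i x) + B (u x) (v2 i x)) (at 0)" for i
    using u v vd[of "\<lambda>r. u (x + r *\<^sub>R axis i 1)" "u1 i x" 0 UNIV "\<lambda>r. v1 i (x + r *\<^sub>R axis i 1)" "v2 i x"]
    by (simp add: axis_derivs2_def add.commute)
  ultimately show ?thesis
    unfolding axis_derivs2_def
    by (auto intro!: derivative_eq_intros simp: scaleR_2)
qed

lemmas axis_derivs2_mult = axis_derivs2_bilinear[OF bounded_bilinear_mult]
lemmas axis_derivs2_inner = axis_derivs2_bilinear[OF bounded_bilinear_inner]
lemmas axis_derivs2_scaleR = axis_derivs2_bilinear[OF bounded_bilinear_scaleR]

lemma axis_derivs2_powr:
  fixes u :: "real^'n \<Rightarrow> real"
  assumes u: "axis_derivs2 u u1 u2 x" and pos: "u x > 0"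
  shows "axis_derivs2 (\<lambda>x. u x powr b) (\<lambda>i x. b * u x powr (b - 1) * u1 i x)
           (\<lambda>i x. b * (b - 1) * u x powr (b - 2) * (u1 i x)\<^sup>2 + b * u x powr (b - 1) * u2 i x) x"
proof -
  have u1: "((\<lambda>r. u (x + r *\<^sub>R axis i 1)) has_real_derivative u1 i x) (at 0)"
    and u2: "((\<lambda>r. u1 i (x + r *\<^sub>R axis i 1)) has_real_derivative u2 i x) (at 0)" for i
    using u by (auto simp: axis_derivs2_def has_real_derivative_iff_has_vector_derivative)
  have *: "((\<lambda>r. u (x + r *\<^sub>R axis i 1) powr c) has_real_derivative c * u x powr (c - 1) * u1 i x) (at 0)"
    for i c
    using pos by (auto intro!: derivative_eq_intros u1)
  have "((\<lambda>r. b * u (x + r *\<^sub>R axis i 1) powr (b - 1) * u1 i (x + r *\<^sub>R axis i 1))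
     has_real_derivative
       b * (b - 1) * u x powr (b - 2) * (u1 i x)\<^sup>2 + b * u x powr (b - 1) * u2 i x) (at 0)" for i
    using DERIV_mult[OF DERIV_cmult[OF *[where c="b - 1" and i=i], of b] u2]
    by (simp add: algebra_simps power2_eq_square)
  with * show ?thesis
    by (simp add: axis_derivs2_def has_real_derivative_iff_has_vector_derivative)
qed

lemma axis_derivs2_eqI:
  assumes "axis_derivs2 u u1 u2 x" "\<And>y. u y = v y" "\<And>i y. u1 i y = v1 i y" "\<And>i. u2 i x = v2 i x"
  shows "axis_derivs2 v v1 v2 x"
  using assms unfolding axis_derivs2_def by simp

text \<open>A positive \<open>l\<close> would make \<open>\<phi>'\<close> positive just to the right
  of its zero at 0, and \<open>\<phi>\<close> would rise above its maximum.\<close>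

lemma second_derivative_nonpos_at_max:
  fixes \<phi> :: "real \<Rightarrow> real"
  assumes "d > 0"
    and 1: "\<And>r. \<bar>r\<bar> < d \<Longrightarrow> (\<phi> has_real_derivative \<phi>' r) (at r)"
    and 2: "(\<phi>' has_real_derivative l) (at 0)"
    and max: "\<And>r. \<bar>r\<bar> < d \<Longrightarrow> \<phi> r \<le> \<phi> 0"
  shows "l \<le> 0"
proof (rule ccontr)
  assume "\<not> l \<le> 0"
  have "\<phi>' 0 = 0"
    by (rule DERIV_local_max[OF 1 \<open>d > 0\<close>]) (use max \<open>d > 0\<close> in auto)
  with DERIV_pos_inc_right[OF 2] \<open>\<not> l \<le> 0\<close>
  obtain e where e: "e > 0" "\<And>h. 0 < h \<Longrightarrow> h < e \<Longrightarrow> \<phi>' h > 0" by auto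
  define h where "h = min d e / 2"
  have h: "0 < h" "h < d" "h < e" using e \<open>d > 0\<close> by (auto simp: h_def min_def field_simps)
  have "\<phi> 0 < \<phi> h"
  proof (rule DERIV_pos_imp_increasing_open[OF h(1)])
    show "\<exists>y. (\<phi> has_real_derivative y) (at r) \<and> 0 < y" if "0 < r" "r < h" for r
      using 1[of r] e(2)[of r] h that by auto
    show "continuous_on {0..h} \<phi>"
      by (rule DERIV_continuous_on, rule has_field_derivative_at_within, rule 1) (use h in auto)
  qed
  with max[of h] h show False by auto
qed

text \<open>The form of the maximum principle used throughout: the one-variable test is applied on
  each axis line through \<open>x\<close>, so a function with positive Laplacian has no interior
  maximum.\<close>

lemma sum_axis_second_derivs_nonpos_at_max:
  fixes w :: "real^'n \<Rightarrow> real"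
  assumes U: "open U" "x \<in> U"
    and w: "\<And>y. y \<in> U \<Longrightarrow> axis_derivs2 w w1 w2 y"
    and max: "\<And>y. y \<in> U \<Longrightarrow> w y \<le> w x"
  shows "(\<Sum>i\<in>UNIV. w2 i x) \<le> 0"
proof (rule sum_nonpos)
  fix i :: 'n
  obtain d where d: "d > 0" "ball x d \<subseteq> U" using U open_contains_ball by blast
  have inU: "x + r *\<^sub>R axis i 1 \<in> U" if "\<bar>r\<bar> < d" for r
    using d that by (auto simp: dist_norm subset_iff)
  show "w2 i x \<le> 0"
  proof (rule second_derivative_nonpos_at_max[OF d(1)])
    fix r :: real assume r: "\<bar>r\<bar> < d"
    have "((\<lambda>s. w ((x + r *\<^sub>R axis i 1) + s *\<^sub>R axis i 1)) has_real_derivative w1 i (x + r *\<^sub>R axis i 1)) (at 0)"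
      using w[OF inU[OF r]] by (simp add: axis_derivs2_def has_real_derivative_iff_has_vector_derivative)
    then have "((\<lambda>s. w (x + (s + r) *\<^sub>R axis i 1)) has_real_derivative w1 i (x + r *\<^sub>R axis i 1)) (at 0)"
      by (simp add: algebra_simps)
    then show "((\<lambda>r. w (x + r *\<^sub>R axis i 1)) has_real_derivative w1 i (x + r *\<^sub>R axis i 1)) (at r)"
      using DERIV_shift[of "\<lambda>s. w (x + s *\<^sub>R axis i 1)" _ 0 r] by simp
  next
    show "((\<lambda>r. w1 i (x + r *\<^sub>R axis i 1)) has_real_derivative w2 i x) (at 0)"
      using w[OF U(2)] by (simp add: axis_derivs2_def has_real_derivative_iff_has_vector_derivative)
  qed (use max inU in auto)
qed

subsection \<open>Harmonic quasiconformal mappings\<close>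

text \<open>With \<open>m\<close> and \<open>s\<close> the least and greatest stretching of
  \<open>D\<close>, the transpose of \<open>D\<close> also stretches by at least \<open>m\<close>,
  while each column of \<open>D\<close> has norm at most \<open>s \<le> K * m\<close>.\<close>

lemma sum_inner_squares_lower_bound:
  fixes D :: "real^'n \<Rightarrow> real^'n"
  assumes D: "linear D" and K: "K \<ge> 1"
    and qc: "(SUP h\<in>sphere 0 1. norm (D h)) \<le> K * (INF h\<in>sphere 0 1. norm (D h))"
  shows "(\<Sum>i\<in>UNIV. (\<tau> \<bullet> D (axis i 1))\<^sup>2)
           \<ge> 1 / (real CARD('n) * K\<^sup>2) * (norm \<tau>)\<^sup>2 * (\<Sum>i\<in>UNIV. (norm (D (axis i 1)))\<^sup>2)"
proof -
  define m where "m = (INF h\<in>sphere 0 1. norm (D h))"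
  define s where "s = (SUP h\<in>sphere 0 1. norm (D h))"
  have bl: "bounded_linear D" using D linear_conv_bounded_linear by blast
  have bdd: "bdd_above ((\<lambda>h. norm (D h)) ` sphere 0 1)"
    by (rule bdd_aboveI2[of _ _ "onorm D"]) (use onorm[OF bl] in \<open>metis mem_sphere_0 mult.right_neutral\<close>)
  have up: "norm (D h) \<le> s" if "norm h = 1" for h
    unfolding s_def using that by (intro cSUP_upper bdd) auto
  have low: "m \<le> norm (D h)" if "norm h = 1" for h
    unfolding m_def using that by (intro cINF_lower bdd_belowI2[of _ 0]) auto
  have low': "m * norm h \<le> norm (D h)" for h
  proof (cases "h = 0")
    case False
    have "m \<le> norm (D ((1 / norm h) *\<^sub>R h))" by (rule low) (use False in simp)
    also have "\<dots> = norm (D h) / norm h" by (simp add: linear_cmul[OF D])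
    finally show ?thesis using False by (simp add: field_simps)
  qed simp
  have "s \<ge> 0" by (rule order_trans[OF norm_ge_zero up[of "axis undefined 1"]]) simp
  have ne: "sphere (0::real^'n) 1 \<noteq> {}"
    by (metis norm_axis_1 mem_sphere_0 empty_iff)
  have "m \<ge> 0" unfolding m_def by (intro cINF_greatest ne) simp
  have S: "(\<Sum>i\<in>UNIV. (norm (D (axis i 1)))\<^sup>2) \<le> real CARD('n) * s\<^sup>2"
    using sum_bounded_above[of "UNIV :: 'n set" "\<lambda>i. (norm (D (axis i 1)))\<^sup>2" "s\<^sup>2"]
    by (simp add: up power_mono)
  have sm: "s\<^sup>2 \<le> K\<^sup>2 * m\<^sup>2"
    using qc \<open>s \<ge> 0\<close> power_mono[of s "K * m" 2] by (simp add: s_def m_def power_mult_distrib)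
  have low_\<tau>: "m\<^sup>2 * (norm \<tau>)\<^sup>2 \<le> (\<Sum>i\<in>UNIV. (\<tau> \<bullet> D (axis i 1))\<^sup>2)"
  proof (cases "m > 0")
    case False
    with \<open>m \<ge> 0\<close> show ?thesis by (simp add: sum_nonneg)
  next
    case True
    have "inj D"
      unfolding linear_injective_0[OF D]
    proof (intro allI impI)
      fix h assume "D h = 0"
      with low'[of h] have "m * norm h \<le> 0" by simp
      with True show "h = 0" by (simp add: mult_le_0_iff)
    qed
    then have "surj D" using D linear_injective_imp_surjective by blast
    then obtain h where h: "D h = \<tau>" by (metis surjD)
    \<comment> \<open>\<open>w\<close> is the transpose of \<open>D\<close> applied to
      \<open>\<tau>\<close>. Pairing it with a preimage \<open>h\<close> of \<open>\<tau>\<close>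
      gives the square of \<open>norm \<tau>\<close>, and
      \<open>m * norm h \<le> norm \<tau>\<close> turns Cauchy-Schwarz into the bound.\<close>
    define w where "w = (\<chi> i. \<tau> \<bullet> D (axis i 1))"
    have "D h = D (\<Sum>i\<in>UNIV. h $ i *s axis i 1)" by (simp add: basis_expansion)
    also have "\<dots> = (\<Sum>i\<in>UNIV. (h $ i) *\<^sub>R D (axis i 1))"
      by (simp add: linear_sum[OF D] scalar_mult_eq_scaleR linear_cmul[OF D])
    finally have "\<tau> \<bullet> \<tau> = \<tau> \<bullet> (\<Sum>i\<in>UNIV. (h $ i) *\<^sub>R D (axis i 1))" using h by simp
    moreover have "w \<bullet> h = (\<Sum>i\<in>UNIV. h $ i * (\<tau> \<bullet> D (axis i 1)))"
      by (subst inner_vec_def) (simp add: w_def mult.commute)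
    ultimately have "(norm \<tau>)\<^sup>2 = w \<bullet> h"
      by (simp add: power2_norm_eq_inner inner_sum_right)
    also have "\<dots> \<le> norm w * norm h" by (rule norm_cauchy_schwarz)
    finally have "m * (norm \<tau>)\<^sup>2 \<le> norm w * (m * norm h)"
      using True by (simp add: mult.left_commute)
    also have "\<dots> \<le> norm w * norm \<tau>"
      using low'[of h] h by (simp add: mult_left_mono)
    finally have "m * norm \<tau> \<le> norm w"
      by (cases "\<tau> = 0") (auto simp: power2_eq_square)
    then have "m\<^sup>2 * (norm \<tau>)\<^sup>2 \<le> (norm w)\<^sup>2"
      using True power_mono[of "m * norm \<tau>" "norm w" 2] by (simp add: power_mult_distrib)
    also have "\<dots> = (\<Sum>i\<in>UNIV. (\<tau> \<bullet> D (axis i 1))\<^sup>2)"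
      unfolding power2_norm_eq_inner
      by (subst inner_vec_def) (simp add: w_def power2_eq_square)
    finally show ?thesis .
  qed
  have "(norm \<tau>)\<^sup>2 * (\<Sum>i\<in>UNIV. (norm (D (axis i 1)))\<^sup>2)
      \<le> (norm \<tau>)\<^sup>2 * (real CARD('n) * (K\<^sup>2 * m\<^sup>2))"
    by (intro mult_left_mono order_trans[OF S] sm) auto
  also have "\<dots> = (m\<^sup>2 * (norm \<tau>)\<^sup>2) * (real CARD('n) * K\<^sup>2)" by simp
  also have "\<dots> \<le> (\<Sum>i\<in>UNIV. (\<tau> \<bullet> D (axis i 1))\<^sup>2) * (real CARD('n) * K\<^sup>2)"
    by (intro mult_right_mono low_\<tau>) simp
  finally have "(norm \<tau>)\<^sup>2 * (\<Sum>i\<in>UNIV. (norm (D (axis i 1)))\<^sup>2)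
      \<le> (\<Sum>i\<in>UNIV. (\<tau> \<bullet> D (axis i 1))\<^sup>2) * (real CARD('n) * K\<^sup>2)" .
  moreover have "real CARD('n) * K\<^sup>2 > 0" using K by simp
  ultimately show ?thesis
    using pos_divide_le_eq by (metis (no_types, lifting) mult_1 times_divide_eq_left)
qed

text \<open>\<open>P i\<close> and \<open>P2 i\<close> are the first and second partial derivatives of \<open>f\<close> in direction \<open>i\<close>. The
  distortion condition bounds the transposed derivative from below: \<open>|Df\<^sup>T \<tau>| \<ge> \<surd>\<kappa> |\<tau>| |Df|\<close>.\<close>

locale harmonic_qc =
  fixes f :: "real^'n \<Rightarrow> real^'n" and P P2 :: "'n \<Rightarrow> real^'n \<Rightarrow> real^'n" and \<kappa> :: real
  assumes derivs: "\<And>x. x \<in> ball 0 1 \<Longrightarrow> axis_derivs2 f P P2 x"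
    and deriv: "\<And>x. x \<in> ball 0 1 \<Longrightarrow> (f has_derivative (\<lambda>h. \<Sum>i\<in>UNIV. (h $ i) *\<^sub>R P i x)) (at x)"
    and cont_P: "\<And>i. continuous_on (ball 0 1) (P i)"
    and laplace: "\<And>x. x \<in> ball 0 1 \<Longrightarrow> (\<Sum>i\<in>UNIV. P2 i x) = 0"
    and \<kappa>_pos: "\<kappa> > 0"
    and distortion: "\<And>x \<tau>. x \<in> ball 0 1 \<Longrightarrow>
      \<kappa> * (norm \<tau>)\<^sup>2 * (\<Sum>i\<in>UNIV. (norm (P i x))\<^sup>2) \<le> (\<Sum>i\<in>UNIV. (\<tau> \<bullet> P i x)\<^sup>2)"

text \<open>Passes from the componentwise definitions to vector-valued derivatives. A harmonic
  mapping is differentiable everywhere, so the distortion inequality is available at each point of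
  the ball and gives the constant through \<open>sum_inner_squares_lower_bound\<close>.\<close>

lemma harmonic_qcI:
  fixes f :: "real^'n \<Rightarrow> real^'n"
  assumes harm: "harmonic_mapping_on (ball 0 1) f" and K: "K_quasiconformal K (ball 0 1) V f"
  shows "\<exists>P P2. harmonic_qc f P P2 (1 / (real CARD('n) * K\<^sup>2))"
proof -
  define P where "P i x = (\<chi> j. partial_derivative i (\<lambda>x. f x $ j) x)" for i x
  define P2 where "P2 i x = (\<chi> j. partial_derivative i (partial_derivative i (\<lambda>x. f x $ j)) x)" for i x
  have h: "harmonic_function_on (ball 0 1) (\<lambda>x. f x $ j)" for j
    using harm by (simp add: harmonic_mapping_on_def)
  \<comment> \<open>A Frechet derivative supplies both existence and value of the partial
    derivatives, which \<open>partial_derivative\<close> by itself only describes through a choice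
    operator.\<close>
  have pd: "((\<lambda>t. u (x + t *\<^sub>R axis i 1)) has_vector_derivative partial_derivative i u x) (at 0)"
      "partial_derivative i u x = blinfun_apply u' (axis i 1)"
    if "(u has_derivative blinfun_apply u') (at x)" for u :: "real^'n \<Rightarrow> real" and u' x i
  proof -
    have "((\<lambda>t. u (x + t *\<^sub>R axis i 1)) has_derivative (\<lambda>t. blinfun_apply u' (t *\<^sub>R axis i 1))) (at 0)"
      using that by (intro has_derivative_compose[of "\<lambda>t. x + t *\<^sub>R axis i 1", where g=u])
        (auto intro!: derivative_eq_intros)
    then have *: "((\<lambda>t. u (x + t *\<^sub>R axis i 1)) has_vector_derivative blinfun_apply u' (axis i 1)) (at 0)"
      by (simp add: has_vector_derivative_def blinfun.scaleR_right)
    show "partial_derivative i u x = blinfun_apply u' (axis i 1)"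
      unfolding partial_derivative_def by (rule vector_derivative_at[OF *])
    with * show "((\<lambda>t. u (x + t *\<^sub>R axis i 1)) has_vector_derivative partial_derivative i u x) (at 0)"
      by simp
  qed
  have C1: "\<exists>u'. (\<forall>x\<in>ball 0 1. (u has_derivative blinfun_apply (u' x)) (at x)) \<and> continuous_on (ball 0 1) u'"
    if "C1_on (ball 0 1) u" for u :: "real^'n \<Rightarrow> real"
    using that unfolding C1_on_def by (metis at_within_open open_ball)
  have "\<forall>j. \<exists>u'. (\<forall>x\<in>ball 0 1. ((\<lambda>x. f x $ j) has_derivative blinfun_apply (u' x)) (at x))
           \<and> continuous_on (ball 0 1) u'"
    using h C1 by (auto simp: harmonic_function_on_def)
  then obtain F where F: "\<And>j x. x \<in> ball 0 1 \<Longrightarrow> ((\<lambda>x. f x $ j) has_derivative blinfun_apply (F j x)) (at x)"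
    and Fc: "\<And>j. continuous_on (ball 0 1) (F j)" by metis
  have PF: "P i x $ j = blinfun_apply (F j x) (axis i 1)" if "x \<in> ball 0 1" for i j x
    by (simp add: P_def pd(2)[OF F[OF that]])
  have vec: "(g has_vector_derivative g') (at 0)"
    if "\<And>j. ((\<lambda>t. g t $ j) has_vector_derivative g' $ j) (at 0)"
    for g :: "real \<Rightarrow> real^'n" and g'
    using that unfolding has_vector_derivative_def
    by (subst has_derivative_componentwise_within)
       (auto simp: Basis_vec_def inner_axis has_vector_derivative_def)
  have A: "axis_derivs2 f P P2 x" if x: "x \<in> ball 0 1" for x
    unfolding axis_derivs2_def
  proof (intro allI conjI vec)
    fix i j
    show "((\<lambda>t. f (x + t *\<^sub>R axis i 1) $ j) has_vector_derivative P i x $ j) (at 0)"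
      using pd(1)[OF F[OF x]] by (simp add: P_def)
    obtain u' where "(partial_derivative i (\<lambda>x. f x $ j) has_derivative blinfun_apply (u' x)) (at x)"
      using C1 h[of j] x unfolding harmonic_function_on_def by metis
    from pd(1)[OF this]
    show "((\<lambda>t. P i (x + t *\<^sub>R axis i 1) $ j) has_vector_derivative P2 i x $ j) (at 0)"
      by (simp add: P_def P2_def)
  qed
  have D: "(f has_derivative (\<lambda>h. \<Sum>i\<in>UNIV. (h $ i) *\<^sub>R P i x)) (at x)" if x: "x \<in> ball 0 1" for x
  proof -
    have "((\<lambda>x. f x $ j) has_derivative (\<lambda>h. \<Sum>i\<in>UNIV. h $ i * P i x $ j)) (at x)" for j
    proof -
      have "blinfun_apply (F j x) h = (\<Sum>i\<in>UNIV. h $ i * P i x $ j)" for h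
      proof -
        have "blinfun_apply (F j x) h = blinfun_apply (F j x) (\<Sum>i\<in>UNIV. h $ i *s axis i 1)"
          by (simp add: basis_expansion)
        also have "\<dots> = (\<Sum>i\<in>UNIV. h $ i * P i x $ j)"
          by (simp add: blinfun.sum_right scalar_mult_eq_scaleR blinfun.scaleR_right PF[OF x])
        finally show ?thesis .
      qed
      then show ?thesis using F[OF x, of j] by presburger
    qed
    then show ?thesis
      by (subst has_derivative_componentwise_within)
         (auto simp: Basis_vec_def inner_axis sum_component)
  qed
  have C: "continuous_on (ball 0 1) (P i)" for i
  proof -
    have "continuous_on (ball 0 1) (\<lambda>x. \<chi> j. blinfun_apply (F j x) (axis i 1))"
      by (intro continuous_on_vec_lambda continuous_intros Fc)
    then show ?thesis
      by (rule continuous_on_eq) (simp add: vec_eq_iff PF)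
  qed
  have L: "(\<Sum>i\<in>UNIV. P2 i x) = 0" if "x \<in> ball 0 1" for x
    using h that by (simp add: vec_eq_iff P2_def harmonic_function_on_def sum_component)
  have K1: "K \<ge> 1" using K by (simp add: K_quasiconformal_def)
  have Q: "1 / (real CARD('n) * K\<^sup>2) * (norm \<tau>)\<^sup>2 * (\<Sum>i\<in>UNIV. (norm (P i x))\<^sup>2)
     \<le> (\<Sum>i\<in>UNIV. (\<tau> \<bullet> P i x)\<^sup>2)" if x: "x \<in> ball 0 1" for x \<tau>
  proof -
    let ?D = "\<lambda>h. \<Sum>i\<in>UNIV. (h $ i) *\<^sub>R P i x"
    have "?D (axis i 1) = P i x" for i
      by (simp add: axis_def if_distrib[of "\<lambda>c. c *\<^sub>R _"] cong: if_cong)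
    moreover have "linear ?D" using D[OF x] has_derivative_linear by blast
    moreover have "(SUP h\<in>sphere 0 1. norm (?D h)) \<le> K * (INF h\<in>sphere 0 1. norm (?D h))"
      using K D[OF x] x unfolding K_quasiconformal_def by blast
    ultimately show ?thesis
      using sum_inner_squares_lower_bound[of ?D K \<tau>] K1 by simp
  qed
  have "harmonic_qc f P P2 (1 / (real CARD('n) * K\<^sup>2))"
    by unfold_locales (use A D C L Q K1 in auto)
  then show ?thesis by blast
qed

subsection \<open>Barriers at boundary points\<close>

lemma axis_derivs2_shift:
  assumes "axis_derivs2 u u1 u2 (x + v)"
  shows "axis_derivs2 (\<lambda>x. u (x + v)) (\<lambda>i x. u1 i (x + v)) (\<lambda>i x. u2 i (x + v)) x"
proof -
  have eq: "x + r *\<^sub>R axis i 1 + v = (x + v) + r *\<^sub>R axis i 1" for r i by (simp add: add_ac)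
  show ?thesis using assms unfolding axis_derivs2_def eq .
qed

text \<open>Bernstein's computation: in the Laplacian of the cutoff times
  \<open>(norm (g x))^2\<close> the mixed term is absorbed by the squared gradient of
  \<open>g\<close>, so that the remaining loss involves only \<open>g\<close> itself.\<close>

lemma axis_derivs2_cutoff_energy:
  fixes g :: "real^'n \<Rightarrow> 'b::real_inner" and x0 :: "real^'n"
  assumes g: "\<And>x. x \<in> U \<Longrightarrow> axis_derivs2 g g1 g2 x"
    and harm: "\<And>x. x \<in> U \<Longrightarrow> (\<Sum>i\<in>UNIV. g2 i x) = 0"
    and U: "U \<subseteq> ball x0 s"
  shows "\<exists>w1 w2. \<forall>x\<in>U. axis_derivs2 (\<lambda>x. (s\<^sup>2 - (norm (x - x0))\<^sup>2)\<^sup>2 * (norm (g x))\<^sup>2) w1 w2 x \<and>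
           - ((24 + 4 * real CARD('n)) * s\<^sup>2 * (norm (g x))\<^sup>2) \<le> (\<Sum>i\<in>UNIV. w2 i x)"
proof -
  define \<eta> where "\<eta> x = s\<^sup>2 - (norm (x - x0))\<^sup>2" for x
  define \<eta>1 where "\<eta>1 i x = - 2 * ((x - x0) \<bullet> axis i 1)" for i x
  define w1 where "w1 i x = 2 * \<eta> x * \<eta>1 i x * (g x \<bullet> g x) + \<eta> x * \<eta> x * (2 * (g x \<bullet> g1 i x))" for i x
  define w2 where "w2 i x = (2 * (\<eta>1 i x)\<^sup>2 - 4 * \<eta> x) * (g x \<bullet> g x)
      + 2 * (2 * \<eta> x * \<eta>1 i x) * (2 * (g x \<bullet> g1 i x))
      + \<eta> x * \<eta> x * (2 * (g1 i x \<bullet> g1 i x) + 2 * (g x \<bullet> g2 i x))" for i x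
  have \<eta>D: "axis_derivs2 \<eta> \<eta>1 (\<lambda>i x. - 2) x" for x
  proof -
    have d: "axis_derivs2 (\<lambda>x. x - x0) (\<lambda>i x. axis i 1) (\<lambda>i x. 0) x"
      by (rule axis_derivs2_eqI[OF axis_derivs2_diff[OF axis_derivs2_ident axis_derivs2_const]]) auto
    show ?thesis
      by (rule axis_derivs2_eqI[OF axis_derivs2_diff[OF axis_derivs2_const[of "s\<^sup>2"] axis_derivs2_inner[OF d d]]])
         (auto simp: \<eta>_def \<eta>1_def power2_norm_eq_inner inner_commute inner_axis_axis)
  qed
  have W: "axis_derivs2 (\<lambda>x. (s\<^sup>2 - (norm (x - x0))\<^sup>2)\<^sup>2 * (norm (g x))\<^sup>2) w1 w2 x" if "x \<in> U" for x
    by (rule axis_derivs2_eqI[OF axis_derivs2_mult[OF axis_derivs2_mult[OF \<eta>D \<eta>D]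
            axis_derivs2_inner[OF g g]]], rule that, rule that)
       (auto simp: w1_def w2_def \<eta>_def dot_square_norm inner_commute power2_eq_square algebra_simps)
  have L: "- ((24 + 4 * real CARD('n)) * s\<^sup>2 * (norm (g x))\<^sup>2) \<le> (\<Sum>i\<in>UNIV. w2 i x)" if x: "x \<in> U" for x
  proof -
    have xs: "norm (x - x0) < s" using U x by (auto simp: dist_norm norm_minus_commute)
    then have \<eta>0: "0 \<le> \<eta> x" and ns: "(norm (x - x0))\<^sup>2 \<le> s\<^sup>2" and \<eta>s: "\<eta> x \<le> s\<^sup>2"
      by (auto simp: \<eta>_def intro: power_mono)
    have low: "- (6 * (\<eta>1 i x)\<^sup>2 + 4 * \<eta> x) * (g x \<bullet> g x) + 2 * (\<eta> x)\<^sup>2 * (g x \<bullet> g2 i x) \<le> w2 i x" for i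
    proof -
      \<comment> \<open>Completing the square: the mixed term and the gradient term together are at
        least \<open>- 8 * (\<eta>1 i x)^2 * (g x \<bullet> g x)\<close>, and -8 + 2 = -6 gives the
        coefficient claimed.\<close>
      have "0 \<le> 2 * (norm (\<eta> x *\<^sub>R g1 i x + (2 * \<eta>1 i x) *\<^sub>R g x))\<^sup>2" by simp
      also have "\<dots> = 2 * (\<eta> x)\<^sup>2 * (g1 i x \<bullet> g1 i x) + 8 * \<eta> x * \<eta>1 i x * (g x \<bullet> g1 i x)
          + 8 * (\<eta>1 i x)\<^sup>2 * (g x \<bullet> g x)"
        unfolding power2_norm_eq_inner
        by (simp add: inner_add_left inner_add_right inner_commute power2_eq_square algebra_simps)
      finally show ?thesis by (simp add: w2_def power2_eq_square algebra_simps)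
    qed
    \<comment> \<open>The 24 of the constant is 6 times this 4; the summand
      \<open>4 * CARD('n)\<close> comes from the Laplacian of \<open>\<eta>\<close>.\<close>
    have s1: "(\<Sum>i\<in>UNIV. (\<eta>1 i x)\<^sup>2) = 4 * (norm (x - x0))\<^sup>2"
      unfolding power2_norm_eq_inner
      by (subst inner_vec_def) (simp add: \<eta>1_def inner_axis power2_eq_square sum_distrib_left algebra_simps)
    have s2: "(\<Sum>i\<in>UNIV. g x \<bullet> g2 i x) = 0"
      using harm[OF x] by (simp flip: inner_sum_right)
    have "- ((24 + 4 * real CARD('n)) * s\<^sup>2 * (norm (g x))\<^sup>2)
        = - ((24 * s\<^sup>2 + 4 * real CARD('n) * s\<^sup>2) * (norm (g x))\<^sup>2)"
      by (simp add: algebra_simps)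
    also have "\<dots> \<le> - ((24 * (norm (x - x0))\<^sup>2 + 4 * real CARD('n) * \<eta> x) * (norm (g x))\<^sup>2)"
      unfolding neg_le_iff_le using ns \<eta>s by (intro mult_right_mono add_mono mult_left_mono) auto
    also have "\<dots> = (\<Sum>i\<in>UNIV. - (6 * (\<eta>1 i x)\<^sup>2 + 4 * \<eta> x) * (g x \<bullet> g x) + 2 * (\<eta> x)\<^sup>2 * (g x \<bullet> g2 i x))"
      by (simp add: sum.distrib s1 s2 dot_square_norm flip: sum_distrib_left sum_distrib_right sum_negf)
         (simp add: sum_subtractf sum_negf s1 algebra_simps flip: sum_distrib_left sum_distrib_right)
    also have "\<dots> \<le> (\<Sum>i\<in>UNIV. w2 i x)" by (rule sum_mono) (rule low)
    finally show ?thesis .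
  qed
  show ?thesis using W L by blast
qed

text \<open>\<open>S\<close> parametrises the boundary points \<open>z \<zeta>\<close>, with inner (not necessarily unit) normals \<open>\<tau> \<zeta>\<close>.
  The conditions on \<open>r0\<close> make the terms of order \<open>\<beta>\<close> in the barrier negligible.\<close>

locale harmonic_qc_barrier = harmonic_qc f P P2 \<kappa>
  for f :: "real^'n \<Rightarrow> real^'n" and P P2 :: "'n \<Rightarrow> real^'n \<Rightarrow> real^'n" and \<kappa> :: real +
  fixes S :: "(real^'n) set" and z \<tau> :: "real^'n \<Rightarrow> real^'n"
    and \<beta> c1 c2 c C0 C A r0 \<rho>1 :: real
  assumes \<beta>: "1 < \<beta>" "\<beta> \<le> 2"
    and S: "compact S" "continuous_on S z" "continuous_on S \<tau>"
    and c1: "c1 > 0" "\<And>\<zeta>. \<zeta> \<in> S \<Longrightarrow> c1 \<le> norm (\<tau> \<zeta>)"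
    and c2: "c2 > 0" "\<And>\<zeta>. \<zeta> \<in> S \<Longrightarrow> norm (\<tau> \<zeta>) \<le> c2"
    and C0: "0 \<le> C0" "2 * C0 < C"
    and A: "C \<le> A * (\<beta> - 1) * \<kappa> * c1 powr \<beta>"
    and r0: "r0 > 0" "A * (c2 * r0) powr (\<beta> - 1) \<le> 1" "C * \<beta> * r0 powr (\<beta> - 1) \<le> c1 / 2"
      "C * r0 powr (\<beta> - 1) < c"
    and bdry: "\<And>\<zeta> \<xi>. \<lbrakk>\<zeta> \<in> S; \<xi> \<in> S; norm (z \<xi> - z \<zeta>) \<le> r0\<rbrakk> \<Longrightarrow>
      \<tau> \<zeta> \<bullet> (z \<xi> - z \<zeta>) \<le> C0 * norm (z \<xi> - z \<zeta>) powr \<beta>"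
    and \<rho>1: "\<rho>1 < 1"
    and near: "\<And>x. \<lbrakk>x \<in> ball 0 1; \<rho>1 \<le> norm x\<rbrakk> \<Longrightarrow>
      \<exists>\<zeta>\<in>S. f x \<noteq> z \<zeta> \<and> norm (f x - z \<zeta>) < r0 \<and> c * norm (f x - z \<zeta>) \<le> \<tau> \<zeta> \<bullet> (f x - z \<zeta>)"
    and proper: "\<And>x y. \<lbrakk>(x, y) \<in> closure ((\<lambda>x. (x, f x)) ` ball 0 1); norm x = 1\<rbrakk> \<Longrightarrow> y \<in> z ` S"
    and bounded_range: "bounded (f ` ball 0 1)"
begin

text \<open>The last term is written as a power of the squared norm, which is smooth away from
  \<open>z \<zeta>\<close>, so that the rule for \<open>powr\<close> applies; \<open>psi_eq\<close>
  restores the norm.\<close>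

definition psi :: "real^'n \<Rightarrow> real^'n \<Rightarrow> real"
  where "psi \<zeta> y = \<tau> \<zeta> \<bullet> (y - z \<zeta>) + A * (\<tau> \<zeta> \<bullet> (y - z \<zeta>)) powr \<beta>
                     - C * ((y - z \<zeta>) \<bullet> (y - z \<zeta>)) powr (\<beta> / 2)"

definition psi1 where
  "psi1 \<zeta> i x = \<tau> \<zeta> \<bullet> P i x
     + A * (\<beta> * (\<tau> \<zeta> \<bullet> (f x - z \<zeta>)) powr (\<beta> - 1) * (\<tau> \<zeta> \<bullet> P i x))
     - C * (\<beta> / 2 * ((f x - z \<zeta>) \<bullet> (f x - z \<zeta>)) powr (\<beta> / 2 - 1) * (2 * ((f x - z \<zeta>) \<bullet> P i x)))"

definition psi2 where
  "psi2 \<zeta> i x = \<tau> \<zeta> \<bullet> P2 i x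
     + A * (\<beta> * (\<beta> - 1) * (\<tau> \<zeta> \<bullet> (f x - z \<zeta>)) powr (\<beta> - 2) * (\<tau> \<zeta> \<bullet> P i x)\<^sup>2
            + \<beta> * (\<tau> \<zeta> \<bullet> (f x - z \<zeta>)) powr (\<beta> - 1) * (\<tau> \<zeta> \<bullet> P2 i x))
     - C * (\<beta> / 2 * (\<beta> / 2 - 1) * ((f x - z \<zeta>) \<bullet> (f x - z \<zeta>)) powr (\<beta> / 2 - 2)
              * (2 * ((f x - z \<zeta>) \<bullet> P i x))\<^sup>2
            + \<beta> / 2 * ((f x - z \<zeta>) \<bullet> (f x - z \<zeta>)) powr (\<beta> / 2 - 1)
              * (2 * (P i x \<bullet> P i x) + 2 * ((f x - z \<zeta>) \<bullet> P2 i x)))"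

lemma C_pos: "C > 0" using C0 by linarith

lemma A_pos: "A > 0"
proof -
  have "0 < A * ((\<beta> - 1) * \<kappa> * c1 powr \<beta>)" using A C_pos by (simp add: mult.assoc)
  moreover have "0 < (\<beta> - 1) * \<kappa> * c1 powr \<beta>" using \<beta> \<kappa>_pos c1 by simp
  ultimately show ?thesis by (simp add: zero_less_mult_iff)
qed

lemma axis_derivs2_psi:
  assumes x: "x \<in> ball 0 1" and t: "\<tau> \<zeta> \<bullet> (f x - z \<zeta>) > 0"
  shows "axis_derivs2 (\<lambda>x. psi \<zeta> (f x)) (psi1 \<zeta>) (psi2 \<zeta>) x"
proof -
  have d: "axis_derivs2 (\<lambda>x. f x - z \<zeta>) P P2 x"
    by (rule axis_derivs2_eqI[OF axis_derivs2_diff[OF derivs[OF x] axis_derivs2_const]]) auto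
  have dt: "axis_derivs2 (\<lambda>x. \<tau> \<zeta> \<bullet> (f x - z \<zeta>)) (\<lambda>i x. \<tau> \<zeta> \<bullet> P i x) (\<lambda>i x. \<tau> \<zeta> \<bullet> P2 i x) x"
    by (rule axis_derivs2_eqI[OF axis_derivs2_inner[OF axis_derivs2_const[of "\<tau> \<zeta>"] d]]) auto
  have dq: "axis_derivs2 (\<lambda>x. (f x - z \<zeta>) \<bullet> (f x - z \<zeta>)) (\<lambda>i x. 2 * ((f x - z \<zeta>) \<bullet> P i x))
      (\<lambda>i x. 2 * (P i x \<bullet> P i x) + 2 * ((f x - z \<zeta>) \<bullet> P2 i x)) x"
    by (rule axis_derivs2_eqI[OF axis_derivs2_inner[OF d d]]) (auto simp: inner_commute)
  have "f x - z \<zeta> \<noteq> 0" using t by auto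
  then have q: "(f x - z \<zeta>) \<bullet> (f x - z \<zeta>) > 0" by simp
  show ?thesis
    by (rule axis_derivs2_eqI[OF axis_derivs2_diff[OF
          axis_derivs2_add[OF dt axis_derivs2_mult[OF axis_derivs2_const[of A] axis_derivs2_powr[OF dt t, of \<beta>]]]
          axis_derivs2_mult[OF axis_derivs2_const[of C] axis_derivs2_powr[OF dq q, of "\<beta> / 2"]]]])
       (simp_all add: psi_def psi1_def psi2_def)
qed

lemma inner_self_powr: "(p \<bullet> p) powr (a / 2) = norm p powr a" for p :: "'b::real_inner"
proof (cases "p = 0")
  case False
  then have "p \<bullet> p = norm p powr 2" by (simp add: dot_square_norm)
  then show ?thesis by (simp only: powr_powr) simp
qed simp

section \<open>Differential inequalities and sign of the barrier\<close>

lemma psi_eq: "psi \<zeta> y = \<tau> \<zeta> \<bullet> (y - z \<zeta>) + A * (\<tau> \<zeta> \<bullet> (y - z \<zeta>)) powr \<beta> - C * norm (y - z \<zeta>) powr \<beta>"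
  by (simp add: psi_def inner_self_powr)

text \<open>Terms linear in \<open>P2\<close> cancel by harmonicity. The gain from
  \<open>A * T powr \<beta>\<close> is at least a multiple of
  \<open>N powr (\<beta> - 2) * V\<close>, the loss from \<open>C * N powr \<beta>\<close> is at
  most such a multiple, and the condition on \<open>A\<close> lets the gain win.\<close>

lemma sum_psi2_nonneg:
  assumes x: "x \<in> ball 0 1" and \<zeta>: "\<zeta> \<in> S" and t: "\<tau> \<zeta> \<bullet> (f x - z \<zeta>) > 0"
  shows "(\<Sum>i\<in>UNIV. psi2 \<zeta> i x) \<ge> 0"
proof -
  define p where "p = f x - z \<zeta>"
  define T where "T = \<tau> \<zeta> \<bullet> p"
  define N where "N = norm p"
  define V where "V = (\<Sum>i\<in>UNIV. (norm (P i x))\<^sup>2)"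
  have "V \<ge> 0" by (simp add: V_def sum_nonneg)
  have T: "T > 0" using t by (simp add: T_def p_def)
  have "p \<noteq> 0" using T by (auto simp: T_def)
  then have N: "N > 0" by (simp add: N_def)
  have TN: "T \<le> norm (\<tau> \<zeta>) * N" unfolding T_def N_def by (rule norm_cauchy_schwarz)
  have \<tau>: "norm (\<tau> \<zeta>) > 0" using c1 \<zeta> by force
  have q: "(p \<bullet> p) powr (\<beta> / 2 - 1) = N powr (\<beta> - 2)"
    using inner_self_powr[of p "\<beta> - 2"] by (simp add: N_def diff_divide_distrib)
  have h1: "(\<Sum>i\<in>UNIV. \<tau> \<zeta> \<bullet> P2 i x) = 0" "(\<Sum>i\<in>UNIV. p \<bullet> P2 i x) = 0"
    using laplace[OF x] by (simp_all flip: inner_sum_right)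
  have lowi: "(\<tau> \<zeta> \<bullet> P2 i x) * (1 + A * (\<beta> * T powr (\<beta> - 1))) - (p \<bullet> P2 i x) * (C * \<beta> * N powr (\<beta> - 2))
      + (\<tau> \<zeta> \<bullet> P i x)\<^sup>2 * (A * \<beta> * (\<beta> - 1) * T powr (\<beta> - 2)) - (norm (P i x))\<^sup>2 * (C * \<beta> * N powr (\<beta> - 2))
      \<le> psi2 \<zeta> i x" for i
  proof -
    \<comment> \<open>As \<open>\<beta> \<le> 2\<close>, the rank-one part of the Hessian of
      \<open>N powr \<beta>\<close> is nonpositive. It enters with factor \<open>- C\<close>, hence
      with a favourable sign, and is dropped.\<close>
    have "0 \<le> C * (\<beta> / 2 * (1 - \<beta> / 2) * (p \<bullet> p) powr (\<beta> / 2 - 2) * (2 * (p \<bullet> P i x))\<^sup>2)"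
      using C_pos \<beta> by (intro mult_nonneg_nonneg) auto
    then show ?thesis
      unfolding psi2_def p_def[symmetric] T_def[symmetric] q power2_norm_eq_inner
      by (simp add: algebra_simps)
  qed
  have "C * N powr (\<beta> - 2) * V \<le> (A * (\<beta> - 1) * \<kappa> * c1 powr \<beta>) * N powr (\<beta> - 2) * V"
    using A \<open>V \<ge> 0\<close> by (intro mult_right_mono) auto
  also have "\<dots> \<le> (A * (\<beta> - 1) * \<kappa> * norm (\<tau> \<zeta>) powr \<beta>) * N powr (\<beta> - 2) * V"
    using A_pos \<beta> \<kappa>_pos c1 \<zeta> \<open>V \<ge> 0\<close> by (intro mult_right_mono mult_left_mono powr_mono2) auto
  also have "\<dots> = A * (\<beta> - 1) * (norm (\<tau> \<zeta>) * N) powr (\<beta> - 2) * (\<kappa> * (norm (\<tau> \<zeta>))\<^sup>2 * V)"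
  proof -
    have "norm (\<tau> \<zeta>) powr \<beta> = norm (\<tau> \<zeta>) powr (\<beta> - 2) * (norm (\<tau> \<zeta>))\<^sup>2"
      using \<tau> by (simp flip: powr_numeral powr_add)
    then show ?thesis using N \<tau> by (simp add: powr_mult)
  qed
  \<comment> \<open>The exponent \<open>\<beta> - 2\<close> is nonpositive and reverses
    \<open>TN\<close>; the distortion bound replaces \<open>V\<close> by the derivatives of
    \<open>\<tau> \<zeta> \<bullet> f\<close>.\<close>
  also have "\<dots> \<le> A * (\<beta> - 1) * T powr (\<beta> - 2) * (\<Sum>i\<in>UNIV. (\<tau> \<zeta> \<bullet> P i x)\<^sup>2)"
    using A_pos \<beta> T TN distortion[OF x, of "\<tau> \<zeta>"] \<kappa>_pos \<open>V \<ge> 0\<close>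
    by (intro mult_mono mult_left_mono powr_mono2') (auto simp: V_def)
  finally have "\<beta> * (C * N powr (\<beta> - 2) * V) \<le> \<beta> * (A * (\<beta> - 1) * T powr (\<beta> - 2) * (\<Sum>i\<in>UNIV. (\<tau> \<zeta> \<bullet> P i x)\<^sup>2))"
    using \<beta> by (intro mult_left_mono) auto
  then have "0 \<le> (\<Sum>i\<in>UNIV. (\<tau> \<zeta> \<bullet> P2 i x) * (1 + A * (\<beta> * T powr (\<beta> - 1))) - (p \<bullet> P2 i x) * (C * \<beta> * N powr (\<beta> - 2))
      + (\<tau> \<zeta> \<bullet> P i x)\<^sup>2 * (A * \<beta> * (\<beta> - 1) * T powr (\<beta> - 2)) - (norm (P i x))\<^sup>2 * (C * \<beta> * N powr (\<beta> - 2)))"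
    by (simp add: sum.distrib sum_subtractf h1 V_def[symmetric] mult_ac flip: sum_distrib_right sum_distrib_left)
  also have "\<dots> \<le> (\<Sum>i\<in>UNIV. psi2 \<zeta> i x)" by (rule sum_mono) (rule lowi)
  finally show ?thesis .
qed

text \<open>By the chain rule \<open>psi1 \<zeta> i x = \<sigma> \<bullet> P i x\<close>, where
  \<open>\<sigma>\<close> is the gradient of the barrier at \<open>f x\<close>. The term with
  \<open>A\<close> only lengthens \<open>\<tau> \<zeta>\<close> and the last term costs at most
  \<open>c1 / 2\<close>, so the distortion bound applies to a vector of length at least
  \<open>c1 / 2\<close>.\<close>

lemma sum_psi1_squares_ge:
  assumes x: "x \<in> ball 0 1" and \<zeta>: "\<zeta> \<in> S" and t: "\<tau> \<zeta> \<bullet> (f x - z \<zeta>) > 0"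
    and r: "norm (f x - z \<zeta>) \<le> r0"
  shows "\<kappa> * (c1 / 2)\<^sup>2 * (\<Sum>i\<in>UNIV. (norm (P i x))\<^sup>2) \<le> (\<Sum>i\<in>UNIV. (psi1 \<zeta> i x)\<^sup>2)"
proof -
  define p where "p = f x - z \<zeta>"
  define T where "T = \<tau> \<zeta> \<bullet> p"
  define N where "N = norm p"
  define B where "B = A * (\<beta> * T powr (\<beta> - 1))"
  define E where "E = C * \<beta> * N powr (\<beta> - 2)"
  define \<sigma> where "\<sigma> = (1 + B) *\<^sub>R \<tau> \<zeta> - E *\<^sub>R p"
  have "p \<noteq> 0" using t by (auto simp: p_def)
  then have N: "N > 0" by (simp add: N_def)
  have q: "(p \<bullet> p) powr (\<beta> / 2 - 1) = N powr (\<beta> - 2)"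
    using inner_self_powr[of p "\<beta> - 2"] by (simp add: N_def diff_divide_distrib)
  have \<sigma>: "psi1 \<zeta> i x = \<sigma> \<bullet> P i x" for i
    unfolding psi1_def p_def[symmetric] T_def[symmetric] q \<sigma>_def B_def E_def
    by (simp add: inner_diff_left algebra_simps)
  have "B \<ge> 0" using A_pos \<beta> by (simp add: B_def)
  have "norm (E *\<^sub>R p) = C * \<beta> * N powr (\<beta> - 1)"
  proof -
    have "N powr (\<beta> - 1) = N powr (\<beta> - 2) * N"
      using N powr_add[of N "\<beta> - 2" 1] by simp
    then show ?thesis using C_pos \<beta> by (simp add: E_def N_def[symmetric])
  qed
  also have "\<dots> \<le> C * \<beta> * r0 powr (\<beta> - 1)"
    using C_pos \<beta> r N by (intro mult_left_mono powr_mono2) (auto simp: N_def p_def)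
  finally have "norm (E *\<^sub>R p) \<le> c1 / 2" using r0 by linarith
  moreover have "norm (\<tau> \<zeta>) \<le> norm ((1 + B) *\<^sub>R \<tau> \<zeta>)"
    using \<open>B \<ge> 0\<close> by (simp add: mult_le_cancel_right1)
  ultimately have "c1 / 2 \<le> norm \<sigma>"
    using norm_triangle_ineq2[of "(1 + B) *\<^sub>R \<tau> \<zeta>" "E *\<^sub>R p"] c1(2)[OF \<zeta>] unfolding \<sigma>_def by linarith
  then have "\<kappa> * (c1 / 2)\<^sup>2 * (\<Sum>i\<in>UNIV. (norm (P i x))\<^sup>2) \<le> \<kappa> * (norm \<sigma>)\<^sup>2 * (\<Sum>i\<in>UNIV. (norm (P i x))\<^sup>2)"
    using \<kappa>_pos c1 by (intro mult_right_mono mult_left_mono power_mono sum_nonneg) auto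
  also have "\<dots> \<le> (\<Sum>i\<in>UNIV. (psi1 \<zeta> i x)\<^sup>2)" unfolding \<sigma> by (rule distortion[OF x])
  finally show ?thesis .
qed

text \<open>By the choice of \<open>r0\<close>, \<open>A * T powr (\<beta> - 1) \<le> 1\<close>: the
  convex term at most doubles the linear one.\<close>

lemma psi_le:
  assumes \<zeta>: "\<zeta> \<in> S" and t: "\<tau> \<zeta> \<bullet> (y - z \<zeta>) \<ge> 0" and r: "norm (y - z \<zeta>) \<le> r0"
  shows "psi \<zeta> y \<le> 2 * (\<tau> \<zeta> \<bullet> (y - z \<zeta>)) - C * norm (y - z \<zeta>) powr \<beta>"
proof -
  define T where "T = \<tau> \<zeta> \<bullet> (y - z \<zeta>)"
  have "A * T powr \<beta> \<le> T"
  proof (cases "T = 0")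
    case False
    then have "T > 0" using t by (simp add: T_def)
    have "T \<le> norm (\<tau> \<zeta>) * norm (y - z \<zeta>)" unfolding T_def by (rule norm_cauchy_schwarz)
    also have "\<dots> \<le> c2 * r0" using c2 \<zeta> r by (intro mult_mono) auto
    finally have "A * T powr (\<beta> - 1) \<le> A * (c2 * r0) powr (\<beta> - 1)"
      using A_pos \<beta> \<open>T > 0\<close> by (intro mult_left_mono powr_mono2) auto
    with r0 have "A * T powr (\<beta> - 1) \<le> 1" by linarith
    then have "A * T powr (\<beta> - 1) * T \<le> 1 * T" using \<open>T > 0\<close> by (intro mult_right_mono) auto
    moreover have "T powr \<beta> = T powr (\<beta> - 1) * T" using \<open>T > 0\<close> powr_add[of T "\<beta> - 1" 1] by simp
    ultimately show ?thesis by simp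
  qed simp
  then show ?thesis by (simp add: psi_eq T_def)
qed

lemma psi_le_const:
  assumes \<zeta>: "\<zeta> \<in> S" and t: "\<tau> \<zeta> \<bullet> (y - z \<zeta>) \<ge> 0" and r: "norm (y - z \<zeta>) \<le> r0"
  shows "psi \<zeta> y \<le> 2 * (c2 * r0)"
proof -
  have "\<tau> \<zeta> \<bullet> (y - z \<zeta>) \<le> norm (\<tau> \<zeta>) * norm (y - z \<zeta>)" by (rule norm_cauchy_schwarz)
  also have "\<dots> \<le> c2 * r0" using c2 \<zeta> r by (intro mult_mono) auto
  finally have "2 * (\<tau> \<zeta> \<bullet> (y - z \<zeta>)) \<le> 2 * (c2 * r0)" by simp
  moreover have "0 \<le> C * norm (y - z \<zeta>) powr \<beta>" using C_pos by simp
  ultimately show ?thesis using psi_le[OF assms] by linarith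
qed

text \<open>Compactness arguments use the closed condition \<open>\<ge> 0\<close>, derivatives of
  the barrier use \<open>> 0\<close>; positivity of the barrier leads from one to the other.\<close>

lemma psi_pos_imp:
  assumes \<zeta>: "\<zeta> \<in> S" and t: "\<tau> \<zeta> \<bullet> (y - z \<zeta>) \<ge> 0" and r: "norm (y - z \<zeta>) \<le> r0"
    and "psi \<zeta> y > 0"
  shows "\<tau> \<zeta> \<bullet> (y - z \<zeta>) > 0"
proof -
  have "0 \<le> C * norm (y - z \<zeta>) powr \<beta>" using C_pos by simp
  then show ?thesis using psi_le[OF assms(1-3)] assms(4) by linarith
qed

text \<open>On the inner side the boundary leaves its tangent plane by at most \<open>C0\<close>
  times the power \<open>\<beta>\<close> of the distance. Twice this is below the last term of the
  barrier, and the gap \<open>2 * C0 < C\<close> makes the sign strict away from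
  \<open>z \<zeta>\<close>.\<close>

lemma psi_boundary:
  assumes \<zeta>: "\<zeta> \<in> S" and t: "\<tau> \<zeta> \<bullet> (y - z \<zeta>) \<ge> 0" and r: "norm (y - z \<zeta>) \<le> r0" and y: "y \<in> z ` S"
  shows "psi \<zeta> y \<le> 0" "y \<noteq> z \<zeta> \<Longrightarrow> psi \<zeta> y < 0"
proof -
  have "\<tau> \<zeta> \<bullet> (y - z \<zeta>) \<le> C0 * norm (y - z \<zeta>) powr \<beta>" using bdry \<zeta> r y by blast
  then have *: "psi \<zeta> y \<le> (2 * C0 - C) * norm (y - z \<zeta>) powr \<beta>"
    using psi_le[OF \<zeta> t r] by (simp add: left_diff_distrib)
  also have "\<dots> \<le> 0" using C0 by (intro mult_nonpos_nonneg) auto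
  finally show "psi \<zeta> y \<le> 0" .
  assume "y \<noteq> z \<zeta>"
  then have "(2 * C0 - C) * norm (y - z \<zeta>) powr \<beta> < 0" using C0 by (intro mult_neg_pos) auto
  with * show "psi \<zeta> y < 0" by linarith
qed

text \<open>Inside the cone given by \<open>c\<close> the linear term dominates the power
  \<open>\<beta>\<close> of the distance at scales below \<open>r0\<close>.\<close>

lemma psi_pos_near:
  assumes "f x \<noteq> z \<zeta>" "norm (f x - z \<zeta>) < r0" "c * norm (f x - z \<zeta>) \<le> \<tau> \<zeta> \<bullet> (f x - z \<zeta>)"
  shows "psi \<zeta> (f x) > 0" "\<tau> \<zeta> \<bullet> (f x - z \<zeta>) > 0"
proof -
  define N where "N = norm (f x - z \<zeta>)"
  have N: "N > 0" "N < r0" using assms by (auto simp: N_def)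
  have "C * N powr (\<beta> - 1) \<le> C * r0 powr (\<beta> - 1)"
    using C_pos \<beta> N by (intro mult_left_mono powr_mono2) auto
  then have "C * N powr (\<beta> - 1) < c" using r0 by linarith
  then have "C * N powr (\<beta> - 1) * N < c * N" using N by simp
  moreover have "N powr \<beta> = N powr (\<beta> - 1) * N" using N powr_add[of N "\<beta> - 1" 1] by simp
  ultimately have *: "C * N powr \<beta> < c * N" by simp
  moreover have "0 \<le> A * (\<tau> \<zeta> \<bullet> (f x - z \<zeta>)) powr \<beta>" "0 \<le> C * N powr \<beta>" using A_pos C_pos by simp_all
  ultimately show "psi \<zeta> (f x) > 0" "\<tau> \<zeta> \<bullet> (f x - z \<zeta>) > 0"
    using assms(3) unfolding psi_eq N_def[symmetric] by linarith+
qed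

lemma continuous_on_psi:
  assumes "continuous_on T a" "continuous_on T b" "\<And>v. v \<in> T \<Longrightarrow> a v \<in> S"
    "\<And>v. v \<in> T \<Longrightarrow> \<tau> (a v) \<bullet> (b v - z (a v)) \<ge> 0"
  shows "continuous_on T (\<lambda>v. psi (a v) (b v))"
proof -
  have za: "continuous_on T (\<lambda>v. z (a v))" "continuous_on T (\<lambda>v. \<tau> (a v))"
    using assms S by (auto intro!: continuous_on_compose2[OF S(2)] continuous_on_compose2[OF S(3)])
  show ?thesis
    unfolding psi_def using \<beta> assms
    by (intro continuous_intros za continuous_on_powr') auto
qed

section \<open>Cluster values at the sphere and comparison with the distance to it\<close>

abbreviation graph :: "((real^'n) \<times> (real^'n)) set"
  where "graph \<equiv> (\<lambda>x. (x, f x)) ` ball 0 1"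

text \<open>The closure of the graph stands in for a continuous extension of \<open>f\<close> to the
  closed ball: it is compact, agrees with the graph over the open ball, and over the sphere consists
  of the cluster values of \<open>f\<close>.\<close>

lemma compact_closure_graph: "compact (closure graph)"
proof -
  have "graph \<subseteq> ball 0 1 \<times> f ` ball 0 1" by auto
  then have "bounded graph" using bounded_range bounded_Times[OF bounded_ball] bounded_subset by blast
  then show ?thesis by simp
qed

lemma continuous_on_f: "continuous_on (ball 0 1) f"
  using deriv by (meson continuous_at_imp_continuous_on has_derivative_continuous)

lemma closure_graph:
  assumes "(x, y) \<in> closure graph"
  shows "norm x \<le> 1" "norm x < 1 \<Longrightarrow> y = f x"
proof -
  obtain v where v: "\<And>n. v n \<in> graph" "v \<longlonglongrightarrow> (x, y)"
    using assms by (auto simp: closure_sequential)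
  then have lim: "(\<lambda>n. fst (v n)) \<longlonglongrightarrow> x" "(\<lambda>n. snd (v n)) \<longlonglongrightarrow> y"
    using tendsto_fst tendsto_snd by fastforce+
  have vn: "fst (v n) \<in> ball 0 1" "snd (v n) = f (fst (v n))" for n using v(1)[of n] by auto
  have "norm (fst (v n)) \<le> 1" for n using vn(1)[of n] by simp
  then show "norm x \<le> 1" using Lim_norm_ubound[OF sequentially_bot lim(1)] by simp
  assume "norm x < 1"
  then have "isCont f x" by (auto intro: has_derivative_continuous[OF deriv])
  then have "(\<lambda>n. f (fst (v n))) \<longlonglongrightarrow> f x" using lim(1) isCont_tendsto_compose by blast
  then show "y = f x" using lim(2) vn(2) LIMSEQ_unique by auto
qed

lemma in_closure_graph: "x \<in> ball 0 1 \<Longrightarrow> (x, f x) \<in> closure graph"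
  by (rule subsetD[OF closure_subset]) auto

text \<open>Keeps the lateral boundary \<open>norm (f x - z \<zeta>) = r0\<close> out of the later
  maximum arguments. Its points with nonnegative barrier form a compact set;
  \<open>psi_boundary\<close> excludes them over the sphere, so \<open>norm x\<close> stays
  uniformly below 1 on this set.\<close>

lemma exists_annulus:
  "\<exists>\<rho>. 0 < \<rho> \<and> \<rho> < 1 \<and> (\<forall>x\<in>ball 0 1. \<forall>\<zeta>\<in>S. norm (f x - z \<zeta>) = r0 \<longrightarrow> \<tau> \<zeta> \<bullet> (f x - z \<zeta>) \<ge> 0 \<longrightarrow>
     psi \<zeta> (f x) \<ge> 0 \<longrightarrow> norm x < \<rho>)"
proof -
  \<comment> \<open>Closedness is shown in two stages: \<open>continuous_on_psi\<close> applies on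
    \<open>X\<close>, where the base of the power is nonnegative, and only then is the condition on
    \<open>psi\<close> added.\<close>
  define X where "X = {v \<in> S \<times> closure graph. norm (snd (snd v) - z (fst v)) = r0 \<and>
      \<tau> (fst v) \<bullet> (snd (snd v) - z (fst v)) \<ge> 0}"
  define Y where "Y = {v \<in> X. psi (fst v) (snd (snd v)) \<ge> 0}"
  have cS: "compact (S \<times> closure graph)" using S compact_closure_graph by (intro compact_Times)
  have zc: "continuous_on (S \<times> closure graph) (\<lambda>v. z (fst v))"
     "continuous_on (S \<times> closure graph) (\<lambda>v. \<tau> (fst v))"
    by (auto intro!: continuous_on_compose2[OF S(2)] continuous_on_compose2[OF S(3)] continuous_intros)
  have "X = (S \<times> closure graph \<inter> (\<lambda>v. norm (snd (snd v) - z (fst v))) -` {r0})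
      \<inter> (S \<times> closure graph \<inter> (\<lambda>v. \<tau> (fst v) \<bullet> (snd (snd v) - z (fst v))) -` {0..})"
    by (auto simp: X_def)
  moreover have "closed \<dots>"
    by (rule closed_Int; rule continuous_closed_preimage)
      (auto intro!: compact_imp_closed[OF cS] continuous_intros zc)
  ultimately have "closed X" by simp
  moreover have "X \<subseteq> S \<times> closure graph" by (auto simp: X_def)
  ultimately have X: "compact X" using compact_Int_closed[OF cS, of X] by (simp add: Int_absorb1)
  have "continuous_on X (\<lambda>v. psi (fst v) (snd (snd v)))"
    by (intro continuous_on_psi continuous_intros) (auto simp: X_def)
  then have "closed (X \<inter> (\<lambda>v. psi (fst v) (snd (snd v))) -` {0..})"
    by (intro continuous_closed_preimage compact_imp_closed[OF X]) auto
  then have "compact (X \<inter> (X \<inter> (\<lambda>v. psi (fst v) (snd (snd v))) -` {0..}))"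
    using X by (intro compact_Int_closed)
  moreover have "X \<inter> (X \<inter> (\<lambda>v. psi (fst v) (snd (snd v))) -` {0..}) = Y" by (auto simp: Y_def)
  ultimately have Y: "compact Y" by simp
  have less1: "norm (fst (snd v)) < 1" if v: "v \<in> Y" for v
  proof (rule ccontr)
    obtain \<zeta> x y where vv: "v = (\<zeta>, x, y)" by (cases v) auto
    assume "\<not> norm (fst (snd v)) < 1"
    with v vv closure_graph(1)[of x y] have "norm x = 1" by (auto simp: Y_def X_def)
    then have yz: "y \<in> z ` S" using proper v vv by (auto simp: Y_def X_def)
    have "norm (y - z \<zeta>) = r0" using v vv by (auto simp: Y_def X_def)
    then have "y \<noteq> z \<zeta>" using r0 by auto
    with psi_boundary(2)[of \<zeta> y] yz v vv show False by (auto simp: Y_def X_def)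
  qed
  show ?thesis
  proof (cases "Y = {}")
    case True
    have False if "x \<in> ball 0 1" "\<zeta> \<in> S" "norm (f x - z \<zeta>) = r0" "\<tau> \<zeta> \<bullet> (f x - z \<zeta>) \<ge> 0" "psi \<zeta> (f x) \<ge> 0" for x \<zeta>
    proof -
      have "(\<zeta>, x, f x) \<in> Y" using that in_closure_graph[of x] by (auto simp: Y_def X_def)
      with True show False by simp
    qed
    then show ?thesis by (intro exI[of _ "1/2"] conjI ballI impI) (simp, simp, blast)
  next
    case False
    have nc: "continuous_on Y (\<lambda>v. norm (fst (snd v)))" by (intro continuous_intros)
    obtain v where v: "v \<in> Y" "\<And>w. w \<in> Y \<Longrightarrow> norm (fst (snd w)) \<le> norm (fst (snd v))"
      using continuous_attains_sup[OF Y False, of "\<lambda>v. norm (fst (snd v))"] nc by blast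
    define \<rho> where "\<rho> = (1 + norm (fst (snd v))) / 2"
    have \<rho>: "0 < \<rho>" "\<rho> < 1" "norm (fst (snd v)) < \<rho>"
      using less1[OF v(1)] norm_ge_zero[of "fst (snd v)"] by (auto simp: \<rho>_def simp del: norm_ge_zero)
    have "norm x < \<rho>" if "x \<in> ball 0 1" "\<zeta> \<in> S" "norm (f x - z \<zeta>) = r0" "\<tau> \<zeta> \<bullet> (f x - z \<zeta>) \<ge> 0" "psi \<zeta> (f x) \<ge> 0" for x \<zeta>
    proof -
      have "(\<zeta>, x, f x) \<in> Y" using that in_closure_graph[of x] by (auto simp: Y_def X_def)
      from v(2)[OF this] \<rho> show ?thesis by simp
    qed
    with \<rho> show ?thesis by blast
  qed
qed

lemma open_good_region:
  assumes U: "open U" "U \<subseteq> ball 0 1" and \<zeta>: "\<zeta> \<in> S"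
  defines "G \<equiv> {x \<in> U. norm (f x - z \<zeta>) < r0 \<and> \<tau> \<zeta> \<bullet> (f x - z \<zeta>) > 0}"
  shows "open G" "open {x \<in> G. psi \<zeta> (f x) > 0}"
proof -
  have c: "continuous_on U f" using continuous_on_f U continuous_on_subset by blast
  have "G = (U \<inter> (\<lambda>x. norm (f x - z \<zeta>)) -` {..<r0}) \<inter> (U \<inter> (\<lambda>x. \<tau> \<zeta> \<bullet> (f x - z \<zeta>)) -` {0<..})"
    by (auto simp: G_def)
  moreover have "open \<dots>"
    by (rule open_Int; rule continuous_open_preimage) (auto intro!: U continuous_intros c)
  ultimately show G: "open G" by simp
  have "continuous_on G (\<lambda>x. psi \<zeta> (f x))"
    by (intro continuous_on_psi continuous_intros continuous_on_subset[OF c]) (auto simp: G_def \<zeta>)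
  then have "open (G \<inter> (\<lambda>x. psi \<zeta> (f x)) -` {0<..})"
    by (intro continuous_open_preimage G) auto
  moreover have "G \<inter> (\<lambda>x. psi \<zeta> (f x)) -` {0<..} = {x \<in> G. psi \<zeta> (f x) > 0}" by auto
  ultimately show "open {x \<in> G. psi \<zeta> (f x) > 0}" by simp
qed

text \<open>Comparison on an annulus with \<open>b\<close>, whose Laplacian is negative. The factor
  makes \<open>b\<close> equal to the bound of \<open>psi_le_const\<close> on the inner sphere. On
  the outer sphere \<open>psi \<le> 0\<close> and \<open>b = 0\<close>; on the lateral boundary and
  where the normal component vanishes, the barrier is not positive.\<close>

lemma psi_le_boundary_distance:
  assumes \<rho>: "0 < \<rho>" "\<rho> < 1"
    and ann: "\<And>x \<zeta>. \<lbrakk>x \<in> ball 0 1; \<zeta> \<in> S; norm (f x - z \<zeta>) = r0; \<tau> \<zeta> \<bullet> (f x - z \<zeta>) \<ge> 0;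
     psi \<zeta> (f x) \<ge> 0\<rbrakk> \<Longrightarrow> norm x < \<rho>"
    and x: "x \<in> ball 0 1" "\<rho> \<le> norm x" and \<zeta>: "\<zeta> \<in> S"
    and r: "norm (f x - z \<zeta>) \<le> r0" and t: "\<tau> \<zeta> \<bullet> (f x - z \<zeta>) \<ge> 0"
  shows "psi \<zeta> (f x) \<le> 2 * (c2 * r0) / (1 - \<rho>\<^sup>2) * (1 - (norm x)\<^sup>2)"
proof (rule ccontr)
  assume neg: "\<not> ?thesis"
  define M where "M = 2 * (c2 * r0) / (1 - \<rho>\<^sup>2)"
  have \<rho>2: "\<rho>\<^sup>2 < 1" using \<rho> by (simp add: power_less_one_iff)
  have M: "M > 0" using c2 r0 \<rho>2 by (simp add: M_def)
  define b where "b x = M * (1 - (norm x)\<^sup>2)" for x :: "real^'n"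
  define E where "E = {v \<in> closure graph. \<rho> \<le> norm (fst v) \<and> norm (snd v - z \<zeta>) \<le> r0 \<and> \<tau> \<zeta> \<bullet> (snd v - z \<zeta>) \<ge> 0}"
  have "E = closure graph \<inter> ((\<lambda>v. norm (fst v)) -` {\<rho>..} \<inter> ((\<lambda>v. norm (snd v - z \<zeta>)) -` {..r0} \<inter>
      (\<lambda>v. \<tau> \<zeta> \<bullet> (snd v - z \<zeta>)) -` {0..}))" by (auto simp: E_def)
  moreover have "compact \<dots>"
    by (intro compact_Int_closed compact_closure_graph closed_Int continuous_closed_vimage continuous_intros)
  ultimately have E: "compact E" by simp
  have xE: "(x, f x) \<in> E" using x r t in_closure_graph by (auto simp: E_def)
  have cE: "continuous_on E (\<lambda>v. psi \<zeta> (snd v) - b (fst v))"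
    unfolding b_def by (intro continuous_intros continuous_on_psi) (auto simp: E_def \<zeta>)
  \<comment> \<open>If the claim failed at \<open>x\<close>, the difference would have a positive
    maximum over the compact set \<open>E\<close>. The boundary pieces are excluded one by one,
    which leaves an interior maximum.\<close>
  obtain v where v: "v \<in> E" "\<And>w. w \<in> E \<Longrightarrow> psi \<zeta> (snd w) - b (fst w) \<le> psi \<zeta> (snd v) - b (fst v)"
    using continuous_attains_sup[OF E _ cE] xE by blast
  obtain x1 y1 where vv: "v = (x1, y1)" by (cases v)
  have v1: "(x1, y1) \<in> closure graph" "\<rho> \<le> norm x1" "norm (y1 - z \<zeta>) \<le> r0" "\<tau> \<zeta> \<bullet> (y1 - z \<zeta>) \<ge> 0"
    using v(1) vv by (auto simp: E_def)
  have gt: "psi \<zeta> y1 > b x1" using v(2)[OF xE] neg by (simp add: vv b_def M_def)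
  have x1: "norm x1 < 1"
  proof (rule ccontr)
    assume "\<not> norm x1 < 1"
    with closure_graph(1)[OF v1(1)] have "norm x1 = 1" by simp
    with proper v1 psi_boundary(1)[OF \<zeta>] gt show False by (fastforce simp: b_def)
  qed
  have y1: "y1 = f x1" using closure_graph(2)[OF v1(1) x1] .
  have "(norm x1)\<^sup>2 < 1" using x1 by (simp add: power_less_one_iff)
  then have b0: "b x1 > 0" using M by (simp add: b_def)
  have r1: "norm (f x1 - z \<zeta>) < r0"
    using ann[of x1 \<zeta>] v1 y1 x1 gt b0 \<zeta> by (cases "norm (f x1 - z \<zeta>) = r0") auto
  have "norm x1 \<noteq> \<rho>"
  proof
    assume "norm x1 = \<rho>"
    then have "b x1 = 2 * (c2 * r0)" using \<rho>2 by (simp add: b_def M_def)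
    with psi_le_const[OF \<zeta> v1(4,3)] gt show False by simp
  qed
  with v1 have \<rho>1: "\<rho> < norm x1" by simp
  have t1: "\<tau> \<zeta> \<bullet> (f x1 - z \<zeta>) > 0" using psi_pos_imp[OF \<zeta> v1(4,3)] gt b0 y1 by simp
  define U where "U = {x \<in> ball 0 1 - cball 0 \<rho>. norm (f x - z \<zeta>) < r0 \<and> \<tau> \<zeta> \<bullet> (f x - z \<zeta>) > 0}"
  have U: "open U" unfolding U_def by (rule open_good_region(1)) (auto simp: \<zeta>)
  have x1U: "x1 \<in> U" using x1 \<rho>1 r1 t1 by (simp add: U_def)
  have D: "axis_derivs2 (\<lambda>x. psi \<zeta> (f x) - b x) (\<lambda>i x. psi1 \<zeta> i x + 2 * M * (x \<bullet> axis i 1))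
      (\<lambda>i x. psi2 \<zeta> i x + 2 * M) x" if "x \<in> U" for x
    by (rule axis_derivs2_eqI[OF axis_derivs2_diff[OF axis_derivs2_psi
          axis_derivs2_mult[OF axis_derivs2_const[of M] axis_derivs2_diff[OF axis_derivs2_const[of 1]
            axis_derivs2_inner[OF axis_derivs2_ident axis_derivs2_ident]]]]])
       (use that in \<open>auto simp: U_def b_def power2_norm_eq_inner inner_commute inner_axis_axis\<close>)
  have "(\<Sum>i\<in>UNIV. psi2 \<zeta> i x1 + 2 * M) \<le> 0"
  proof (rule sum_axis_second_derivs_nonpos_at_max[OF U x1U D])
    fix y assume "y \<in> U"
    then have "(y, f y) \<in> E" using in_closure_graph[of y] by (auto simp: U_def E_def)
    from v(2)[OF this] show "psi \<zeta> (f y) - b y \<le> psi \<zeta> (f x1) - b x1" by (simp add: vv y1)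
  qed
  moreover have "(\<Sum>i\<in>UNIV. psi2 \<zeta> i x1) \<ge> 0" using sum_psi2_nonneg[OF _ \<zeta> t1] x1 by simp
  moreover have "real CARD('n) * (2 * M) > 0" using M by simp
  ultimately show False by (simp add: sum.distrib)
qed

subsection \<open>Gradient bound\<close>

lemma compact_good_pairs:
  assumes K: "compact K" "K \<subseteq> ball 0 1"
  shows "compact {v \<in> K \<times> S. norm (f (fst v) - z (snd v)) \<le> r0 \<and> \<tau> (snd v) \<bullet> (f (fst v) - z (snd v)) \<ge> 0 \<and>
           psi (snd v) (f (fst v)) \<ge> 0}"
proof -
  define X where "X = {v \<in> K \<times> S. norm (f (fst v) - z (snd v)) \<le> r0 \<and> \<tau> (snd v) \<bullet> (f (fst v) - z (snd v)) \<ge> 0}"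
  have cK: "compact (K \<times> S)" using K S by (intro compact_Times)
  have fc: "continuous_on (K \<times> S) (\<lambda>v. f (fst v))"
    using K by (auto intro!: continuous_on_compose2[OF continuous_on_f] continuous_intros)
  have zc: "continuous_on (K \<times> S) (\<lambda>v. z (snd v))" "continuous_on (K \<times> S) (\<lambda>v. \<tau> (snd v))"
    by (auto intro!: continuous_on_compose2[OF S(2)] continuous_on_compose2[OF S(3)] continuous_intros)
  have "X = (K \<times> S \<inter> (\<lambda>v. norm (f (fst v) - z (snd v))) -` {..r0})
      \<inter> (K \<times> S \<inter> (\<lambda>v. \<tau> (snd v) \<bullet> (f (fst v) - z (snd v))) -` {0..})"
    by (auto simp: X_def)
  moreover have "closed \<dots>"
    by (rule closed_Int; rule continuous_closed_preimage)
      (auto intro!: compact_imp_closed[OF cK] continuous_intros zc fc)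
  ultimately have "closed X" by simp
  moreover have XK: "X \<subseteq> K \<times> S" by (auto simp: X_def)
  ultimately have X: "compact X" using compact_Int_closed[OF cK, of X] by (simp add: Int_absorb1)
  have "continuous_on X (\<lambda>v. psi (snd v) (f (fst v)))"
    by (intro continuous_on_psi continuous_intros continuous_on_subset[OF fc XK]) (auto simp: X_def)
  then have "closed (X \<inter> (\<lambda>v. psi (snd v) (f (fst v))) -` {0..})"
    by (intro continuous_closed_preimage compact_imp_closed[OF X]) auto
  then have "compact (X \<inter> (X \<inter> (\<lambda>v. psi (snd v) (f (fst v))) -` {0..}))"
    using X by (intro compact_Int_closed)
  then show ?thesis
    by (rule back_subst[of compact]) (auto simp: X_def)
qed

text \<open>The maximum is taken jointly over \<open>x\<close> and \<open>\<zeta>\<close>, because a barrier for a fixed \<open>\<zeta>\<close> need not be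
  positive at \<open>f x\<close> for all \<open>x\<close> in the small ball. The term with \<open>\<epsilon>\<close> makes the differential
  inequality strict and absorbs the error \<open>\<delta>\<close> of the difference quotient.\<close>

lemma difference_quotient_bound:
  assumes \<rho>: "\<rho>1 \<le> \<rho>"
    and ann: "\<And>x \<zeta>. \<lbrakk>x \<in> ball 0 1; \<zeta> \<in> S; norm (f x - z \<zeta>) = r0; \<tau> \<zeta> \<bullet> (f x - z \<zeta>) \<ge> 0;
     psi \<zeta> (f x) \<ge> 0\<rbrakk> \<Longrightarrow> norm x < \<rho>"
    and M: "M > 0" "\<And>x \<zeta>. \<lbrakk>x \<in> ball 0 1; \<rho> \<le> norm x; \<zeta> \<in> S; norm (f x - z \<zeta>) \<le> r0;
     \<tau> \<zeta> \<bullet> (f x - z \<zeta>) \<ge> 0\<rbrakk> \<Longrightarrow> psi \<zeta> (f x) \<le> M * (1 - (norm x)\<^sup>2)"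
    and x0: "x0 \<in> ball 0 1" and s: "s = (1 - norm x0) / 2" "\<rho> \<le> norm x0 - s"
    and h: "\<bar>h\<bar> < s" "h \<noteq> 0"
    and g: "\<And>x. x \<in> cball x0 s \<Longrightarrow>
      (norm ((1 / h) *\<^sub>R (f (x + h *\<^sub>R axis k 1) - f x)))\<^sup>2 \<le> 2 * (\<Sum>i\<in>UNIV. (norm (P i x))\<^sup>2) + \<delta>"
    and \<delta>: "(24 + 4 * real CARD('n)) * s\<^sup>2 * \<delta> < 2 * real CARD('n) * \<epsilon>" and \<epsilon>: "\<epsilon> > 0"
    and a: "a = (24 + 4 * real CARD('n)) / (\<kappa> * (c1 / 2)\<^sup>2)"
  shows "s ^ 4 * (norm ((1 / h) *\<^sub>R (f (x0 + h *\<^sub>R axis k 1) - f x0)))\<^sup>2 \<le> a * s\<^sup>2 * (6 * M * s)\<^sup>2 + \<epsilon> * s\<^sup>2"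
proof -
  define G where "G x = (1 / h) *\<^sub>R (f (x + h *\<^sub>R axis k 1) - f x)" for x
  define V where "V x = (\<Sum>i\<in>UNIV. (norm (P i x))\<^sup>2)" for x
  have s0: "s > 0" using s x0 by simp
  have a0: "a > 0" using \<kappa>_pos c1 by (simp add: a add_pos_nonneg)
  \<comment> \<open>The distance of \<open>x0\<close> to the sphere is \<open>2 * s\<close>, so on
    the small ball it lies between \<open>s\<close> and \<open>3 * s\<close>. The shift by
    \<open>h\<close> is shorter than \<open>s\<close>, and
    \<open>(1 - norm x) * (1 + norm x) \<le> 3 * s * 2\<close>.\<close>
  have in_ball: "x \<in> ball 0 1" "x + h *\<^sub>R axis k 1 \<in> ball 0 1" "\<rho> \<le> norm x" "1 - (norm x)\<^sup>2 \<le> 6 * s"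
    if "x \<in> cball x0 s" for x
  proof -
    have d: "norm (x - x0) \<le> s" using that by (simp add: dist_norm norm_minus_commute)
    then have n1: "norm x \<le> norm x0 + s" using norm_triangle_sub[of x x0] by simp
    then show "x \<in> ball 0 1" using s0 s by (simp add: field_simps)
    have "norm (x + h *\<^sub>R axis k 1) \<le> norm x + \<bar>h\<bar>"
      using norm_triangle_ineq[of x "h *\<^sub>R axis k 1"] by simp
    then show "x + h *\<^sub>R axis k 1 \<in> ball 0 1" using n1 h s by (simp add: field_simps)
    have n2: "norm x \<ge> norm x0 - s" using d norm_triangle_sub[of x0 x] by (simp add: norm_minus_commute)
    then show "\<rho> \<le> norm x" using s(2) by linarith
    have "1 - (norm x)\<^sup>2 = (1 - norm x) * (1 + norm x)" by (simp add: power2_eq_square algebra_simps)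
    also have "\<dots> \<le> (3 * s) * 2" using n1 n2 s0 s by (intro mult_mono) (auto simp: field_simps)
    finally show "1 - (norm x)\<^sup>2 \<le> 6 * s" by simp
  qed
  have GD: "axis_derivs2 G (\<lambda>i x. (1 / h) *\<^sub>R (P i (x + h *\<^sub>R axis k 1) - P i x))
      (\<lambda>i x. (1 / h) *\<^sub>R (P2 i (x + h *\<^sub>R axis k 1) - P2 i x)) x" if "x \<in> ball x0 s" for x
  proof -
    have x: "x \<in> ball 0 1" "x + h *\<^sub>R axis k 1 \<in> ball 0 1" using in_ball that by auto
    show ?thesis
      by (rule axis_derivs2_eqI[OF axis_derivs2_scaleR[OF axis_derivs2_const[of "1 / h"]
            axis_derivs2_diff[OF axis_derivs2_shift[OF derivs[OF x(2)]] derivs[OF x(1)]]]])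
         (auto simp: G_def)
  qed
  have GL: "(\<Sum>i\<in>UNIV. (1 / h) *\<^sub>R (P2 i (x + h *\<^sub>R axis k 1) - P2 i x)) = 0" if "x \<in> ball x0 s" for x
    using in_ball[of x] that laplace by (simp add: sum_subtractf flip: scaleR_sum_right)
  obtain w1 w2 where w: "\<And>x. x \<in> ball x0 s \<Longrightarrow>
      axis_derivs2 (\<lambda>x. (s\<^sup>2 - (norm (x - x0))\<^sup>2)\<^sup>2 * (norm (G x))\<^sup>2) w1 w2 x"
     "\<And>x. x \<in> ball x0 s \<Longrightarrow> - ((24 + 4 * real CARD('n)) * s\<^sup>2 * (norm (G x))\<^sup>2) \<le> (\<Sum>i\<in>UNIV. w2 i x)"
    using axis_derivs2_cutoff_energy[where U = "ball x0 s", OF GD GL order_refl] by blast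
  \<comment> \<open>With the given \<open>a\<close> the gradient term from the squared barrier
    contributes \<open>(24 + 4 * CARD('n)) * s^2 * (2 * V x)\<close>, exactly the cutoff loss for
    \<open>2 * V x\<close> in place of the squared difference quotient. The
    \<open>\<epsilon>\<close> term outweighs what \<open>\<delta>\<close> adds.\<close>
  define W where "W \<zeta> x = (s\<^sup>2 - (norm (x - x0))\<^sup>2)\<^sup>2 * (norm (G x))\<^sup>2 + a * s\<^sup>2 * (psi \<zeta> (f x))\<^sup>2
       + \<epsilon> * (norm (x - x0))\<^sup>2" for \<zeta> x
  define E where "E = {v \<in> cball x0 s \<times> S. norm (f (fst v) - z (snd v)) \<le> r0 \<and>
       \<tau> (snd v) \<bullet> (f (fst v) - z (snd v)) \<ge> 0 \<and> psi (snd v) (f (fst v)) \<ge> 0}"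
  have E: "compact E" unfolding E_def by (rule compact_good_pairs) (use in_ball in auto)
  have fc: "continuous_on E (\<lambda>v. f (fst v))" "continuous_on E (\<lambda>v. f (fst v + h *\<^sub>R axis k 1))"
    using in_ball by (auto intro!: continuous_on_compose2[OF continuous_on_f] continuous_intros simp: E_def)
  have "continuous_on E (\<lambda>v. W (snd v) (fst v))"
    unfolding W_def G_def
    by (intro continuous_intros continuous_on_psi fc) (auto simp: E_def)
  moreover have good: "\<exists>\<zeta>. (x, \<zeta>) \<in> E \<and> psi \<zeta> (f x) > 0" if xs: "x \<in> cball x0 s" for x
  proof -
    obtain \<zeta> where \<zeta>: "\<zeta> \<in> S" "f x \<noteq> z \<zeta>" "norm (f x - z \<zeta>) < r0" "c * norm (f x - z \<zeta>) \<le> \<tau> \<zeta> \<bullet> (f x - z \<zeta>)"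
      using near[OF in_ball(1)[OF xs]] in_ball(3)[OF xs] \<rho> by auto
    from psi_pos_near[OF \<zeta>(2-4)] \<zeta> xs show ?thesis by (auto simp: E_def intro!: exI[of _ \<zeta>])
  qed
  moreover obtain \<zeta>0 where \<zeta>0: "(x0, \<zeta>0) \<in> E" using good[of x0] s0 by auto
  ultimately obtain v where v: "v \<in> E" "\<And>u. u \<in> E \<Longrightarrow> W (snd u) (fst u) \<le> W (snd v) (fst v)"
    using continuous_attains_sup[OF E, of "\<lambda>v. W (snd v) (fst v)"] by blast
  obtain x \<zeta> where vv: "v = (x, \<zeta>)" by (cases v)
  have max: "W \<zeta>' y \<le> W \<zeta> x" if "(y, \<zeta>') \<in> E" for y \<zeta>' using v(2)[OF that] by (simp add: vv)
  have xE: "x \<in> cball x0 s" "\<zeta> \<in> S" "norm (f x - z \<zeta>) \<le> r0" "\<tau> \<zeta> \<bullet> (f x - z \<zeta>) \<ge> 0" "psi \<zeta> (f x) \<ge> 0"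
    using v(1) by (auto simp: E_def vv)
  note xb = in_ball[OF xE(1)]
  \<comment> \<open>The maximum lies on the small sphere, since \<open>W \<zeta>\<close> would have
    positive Laplacian at an interior one.\<close>
  have "norm (x - x0) = s"
  proof (rule ccontr)
    assume "norm (x - x0) \<noteq> s"
    then have xs: "x \<in> ball x0 s" using xE by (simp add: dist_norm norm_minus_commute)
    \<comment> \<open>Maximality in \<open>\<zeta>\<close>: the other terms of \<open>W\<close> are
      independent of it, so a vanishing barrier at \<open>f x\<close> would be beaten by a positive
      one for another \<open>\<zeta>'\<close>.\<close>
    have pos: "psi \<zeta> (f x) > 0"
    proof (rule ccontr)
      assume "\<not> psi \<zeta> (f x) > 0"
      then have 0: "psi \<zeta> (f x) = 0" using xE by simp
      obtain \<zeta>' where \<zeta>': "(x, \<zeta>') \<in> E" "psi \<zeta>' (f x) > 0" using good xE by blast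
      have "0 < a * s\<^sup>2 * (psi \<zeta>' (f x))\<^sup>2" using a0 s0 \<zeta>' by simp
      with max[OF \<zeta>'(1)] 0 show False by (simp add: W_def)
    qed
    have t: "\<tau> \<zeta> \<bullet> (f x - z \<zeta>) > 0" using psi_pos_imp[OF xE(2,4,3) pos] .
    \<comment> \<open>Equality would force \<open>norm x < \<rho>\<close> by \<open>ann\<close>,
      whereas the small ball stays at radius at least \<open>\<rho>\<close>.\<close>
    have r: "norm (f x - z \<zeta>) < r0"
      using ann[of x \<zeta>] xE xb by (cases "norm (f x - z \<zeta>) = r0") auto
    define U where "U = {y \<in> {y \<in> ball x0 s. norm (f y - z \<zeta>) < r0 \<and> \<tau> \<zeta> \<bullet> (f y - z \<zeta>) > 0}. psi \<zeta> (f y) > 0}"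
    have U: "open U" unfolding U_def by (rule open_good_region(2)) (use xE in_ball in auto)
    have xU: "x \<in> U" using xs r t pos by (simp add: U_def)
    define W2 where "W2 i y = w2 i y + a * s\<^sup>2 * (2 * (psi1 \<zeta> i y)\<^sup>2 + 2 * psi \<zeta> (f y) * psi2 \<zeta> i y) + 2 * \<epsilon>" for i y
    have D: "axis_derivs2 (W \<zeta>) (\<lambda>i y. w1 i y + a * s\<^sup>2 * (2 * psi \<zeta> (f y) * psi1 \<zeta> i y) + \<epsilon> * (2 * ((y - x0) \<bullet> axis i 1)))
        W2 y" if y: "y \<in> U" for y
    proof -
      have y': "y \<in> ball x0 s" "y \<in> ball 0 1" "\<tau> \<zeta> \<bullet> (f y - z \<zeta>) > 0" using y in_ball[of y] by (auto simp: U_def)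
      have d: "axis_derivs2 (\<lambda>x. x - x0) (\<lambda>i x. axis i 1) (\<lambda>i x. 0) y"
        by (rule axis_derivs2_eqI[OF axis_derivs2_diff[OF axis_derivs2_ident axis_derivs2_const]]) auto
      note p = axis_derivs2_psi[OF y'(2,3)]
      show ?thesis
        by (rule axis_derivs2_eqI[OF axis_derivs2_add[OF axis_derivs2_add[OF w(1)[OF y'(1)]
              axis_derivs2_mult[OF axis_derivs2_const[of "a * s\<^sup>2"] axis_derivs2_mult[OF p p]]]
              axis_derivs2_mult[OF axis_derivs2_const[of \<epsilon>] axis_derivs2_inner[OF d d]]]])
           (auto simp: W_def W2_def dot_square_norm inner_commute inner_axis_axis power2_eq_square algebra_simps)
    qed
    have "(\<Sum>i\<in>UNIV. W2 i x) \<le> 0"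
    proof (rule sum_axis_second_derivs_nonpos_at_max[OF U xU D])
      fix y assume "y \<in> U"
      then show "W \<zeta> y \<le> W \<zeta> x" using xE by (intro max) (auto simp: U_def E_def)
    qed
    moreover have "(\<Sum>i\<in>UNIV. W2 i x) = (\<Sum>i\<in>UNIV. w2 i x)
        + a * s\<^sup>2 * (2 * (\<Sum>i\<in>UNIV. (psi1 \<zeta> i x)\<^sup>2) + 2 * psi \<zeta> (f x) * (\<Sum>i\<in>UNIV. psi2 \<zeta> i x))
        + real CARD('n) * (2 * \<epsilon>)"
      by (simp add: W2_def sum.distrib sum_distrib_left distrib_left mult_ac)
    moreover have "a * s\<^sup>2 * (2 * (\<Sum>i\<in>UNIV. (psi1 \<zeta> i x)\<^sup>2) + 2 * psi \<zeta> (f x) * (\<Sum>i\<in>UNIV. psi2 \<zeta> i x))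
        \<ge> a * s\<^sup>2 * (2 * (\<kappa> * (c1 / 2)\<^sup>2 * V x) + 0)"
      unfolding V_def
      using sum_psi1_squares_ge[OF xb(1) xE(2) t xE(3)] sum_psi2_nonneg[OF xb(1) xE(2) t] a0 pos
      by (intro mult_left_mono add_mono) auto
    moreover have "a * s\<^sup>2 * (2 * (\<kappa> * (c1 / 2)\<^sup>2 * V x) + 0) = (24 + 4 * real CARD('n)) * s\<^sup>2 * (2 * V x)"
    proof -
      have "a * (\<kappa> * (c1 / 2)\<^sup>2) = 24 + 4 * real CARD('n)" using \<kappa>_pos c1 by (simp add: a)
      then have "(a * (\<kappa> * (c1 / 2)\<^sup>2)) * (s\<^sup>2 * (2 * V x)) = (24 + 4 * real CARD('n)) * (s\<^sup>2 * (2 * V x))" by simp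
      then show ?thesis by (simp only: add_0_right mult_ac)
    qed
    moreover have "(24 + 4 * real CARD('n)) * s\<^sup>2 * (norm (G x))\<^sup>2 \<le> (24 + 4 * real CARD('n)) * s\<^sup>2 * (2 * V x + \<delta>)"
      using g[OF xE(1)] by (intro mult_left_mono) (auto simp: G_def V_def)
    moreover have "(24 + 4 * real CARD('n)) * s\<^sup>2 * (2 * V x + \<delta>)
        = (24 + 4 * real CARD('n)) * s\<^sup>2 * (2 * V x) + (24 + 4 * real CARD('n)) * s\<^sup>2 * \<delta>"
      by (rule distrib_left)
    ultimately show False using w(2)[OF xs] \<delta> by linarith
  qed
  \<comment> \<open>The cutoff vanishes on the small sphere; at the centre \<open>x0\<close> it
    equals \<open>s ^ 4\<close>.\<close>
  then have "W \<zeta> x = a * s\<^sup>2 * (psi \<zeta> (f x))\<^sup>2 + \<epsilon> * s\<^sup>2" by (simp add: W_def)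
  also have "\<dots> \<le> a * s\<^sup>2 * (6 * M * s)\<^sup>2 + \<epsilon> * s\<^sup>2"
  proof -
    have "psi \<zeta> (f x) \<le> M * (1 - (norm x)\<^sup>2)" using M(2) xb xE by auto
    also have "\<dots> \<le> M * (6 * s)" using M(1) xb by (intro mult_left_mono) auto
    finally show ?thesis using xE a0 s0 \<epsilon> by (intro add_mono mult_left_mono power_mono) auto
  qed
  finally have "W \<zeta> x \<le> a * s\<^sup>2 * (6 * M * s)\<^sup>2 + \<epsilon> * s\<^sup>2" .
  moreover have "s ^ 4 * (norm (G x0))\<^sup>2 \<le> W \<zeta>0 x0"
    using a0 by (simp add: W_def flip: power_mult)
  moreover have "W \<zeta>0 x0 \<le> W \<zeta> x" by (rule max[OF \<zeta>0])
  ultimately show ?thesis by (simp add: G_def)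
qed

text \<open>Linearization along the segment from \<open>x\<close> to the shifted point, with uniform
  continuity of \<open>P k\<close> on a slightly larger closed ball that contains all these
  segments.\<close>

lemma difference_quotient_uniform:
  assumes q: "q < 1" and e: "e > 0"
  shows "\<exists>d>0. \<forall>h. h \<noteq> 0 \<longrightarrow> \<bar>h\<bar> < d \<longrightarrow>
     (\<forall>x\<in>cball 0 q. norm ((1 / h) *\<^sub>R (f (x + h *\<^sub>R axis k 1) - f x) - P k x) \<le> e)"
proof -
  define q' where "q' = (1 + q) / 2"
  have q': "q < q'" "q' < 1" using q by (auto simp: q'_def)
  have cb: "cball 0 q' \<subseteq> (ball 0 1 :: (real^'n) set)" using q' by auto
  have "uniformly_continuous_on (cball 0 q') (P k)"
    by (intro compact_uniformly_continuous continuous_on_subset[OF cont_P cb] compact_cball)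
  then obtain d1 where d1: "d1 > 0" "\<And>x y. x \<in> cball 0 q' \<Longrightarrow> y \<in> cball 0 q' \<Longrightarrow> dist y x < d1 \<Longrightarrow> dist (P k y) (P k x) < e"
    unfolding uniformly_continuous_on_def using e by metis
  define d where "d = min d1 (q' - q)"
  have "norm ((1 / h) *\<^sub>R (f (x + h *\<^sub>R axis k 1) - f x) - P k x) \<le> e"
    if h: "h \<noteq> 0" "\<bar>h\<bar> < d" and x: "x \<in> cball 0 q" for h x
  proof -
    have r: "\<bar>r\<bar> \<le> \<bar>h\<bar>" if "r \<in> closed_segment 0 h" for r
      using that by (auto simp: closed_segment_eq_real_ivl split: if_splits)
    have xr: "x + r *\<^sub>R axis k 1 \<in> cball 0 q'" if "r \<in> closed_segment 0 h" for r
      using norm_triangle_ineq[of x "r *\<^sub>R axis k 1"] r[OF that] h x by (simp add: d_def)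
    have der: "((\<lambda>r. f (x + r *\<^sub>R axis k 1)) has_vector_derivative P k (x + r *\<^sub>R axis k 1)) (at r within closed_segment 0 h)"
      if "r \<in> closed_segment 0 h" for r
    proof -
      have xb: "x + r *\<^sub>R axis k 1 \<in> ball 0 1" using xr[OF that] cb by blast
      have "((\<lambda>r. f (x + r *\<^sub>R axis k 1)) has_derivative
          (\<lambda>t. \<Sum>i\<in>UNIV. ((t *\<^sub>R axis k 1) $ i) *\<^sub>R P i (x + r *\<^sub>R axis k 1))) (at r within closed_segment 0 h)"
        by (rule has_derivative_compose[of "\<lambda>r. x + r *\<^sub>R axis k 1", OF _ deriv[OF xb]])
           (auto intro!: derivative_eq_intros)
      moreover have "(\<Sum>i\<in>UNIV. ((t *\<^sub>R axis k 1) $ i) *\<^sub>R P i y) = t *\<^sub>R P k y" for t y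
        by (simp add: axis_def if_distrib[of "\<lambda>c. c *\<^sub>R _"] if_distrib[of "\<lambda>c. t * c"] cong: if_cong)
      ultimately show ?thesis by (simp add: has_vector_derivative_def)
    qed
    have "norm (f (x + h *\<^sub>R axis k 1) - f (x + 0 *\<^sub>R axis k 1) - (h - 0) *\<^sub>R P k (x + 0 *\<^sub>R axis k 1))
        \<le> norm (h - 0) * e"
    proof (rule vector_differentiable_bound_linearization[of "closed_segment 0 h" _ "\<lambda>r. P k (x + r *\<^sub>R axis k 1)"])
      fix r assume rs: "r \<in> closed_segment 0 h"
      have "dist (P k (x + r *\<^sub>R axis k 1)) (P k x) < e"
      proof (rule d1(2))
        show "x \<in> cball 0 q'" using x q' by simp
        show "x + r *\<^sub>R axis k 1 \<in> cball 0 q'" by (rule xr[OF rs])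
        show "dist (x + r *\<^sub>R axis k 1) x < d1" using r[OF rs] h by (simp add: dist_norm d_def)
      qed
      then show "norm (P k (x + r *\<^sub>R axis k 1) - P k (x + 0 *\<^sub>R axis k 1)) \<le> e" by (simp add: dist_norm)
    qed (auto intro: der)
    then have "norm ((1 / h) *\<^sub>R (f (x + h *\<^sub>R axis k 1) - f x - h *\<^sub>R P k x)) \<le> e"
      using h by (simp add: divide_le_eq mult.commute)
    then show ?thesis using h by (simp add: scaleR_diff_right)
  qed
  moreover have "d > 0" using d1 q' by (simp add: d_def)
  ultimately show ?thesis by blast
qed

text \<open>Near the sphere the bound on the difference quotient is free of \<open>s\<close>,
  because both sides of \<open>difference_quotient_bound\<close> scale like \<open>s ^ 4\<close> for
  \<open>\<epsilon> = s^2\<close>. On the remaining closed ball continuity suffices.\<close>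

lemma partial_derivatives_bounded: "\<exists>L. \<forall>x\<in>ball 0 1. \<forall>k. norm (P k x) \<le> L"
proof -
  obtain \<rho>' where \<rho>': "0 < \<rho>'" "\<rho>' < 1"
    "\<And>x \<zeta>. \<lbrakk>x \<in> ball 0 1; \<zeta> \<in> S; norm (f x - z \<zeta>) = r0; \<tau> \<zeta> \<bullet> (f x - z \<zeta>) \<ge> 0;
     psi \<zeta> (f x) \<ge> 0\<rbrakk> \<Longrightarrow> norm x < \<rho>'"
    using exists_annulus by blast
  define \<rho> where "\<rho> = max \<rho>' \<rho>1"
  have \<rho>: "0 < \<rho>" "\<rho> < 1" "\<rho>1 \<le> \<rho>" using \<rho>' \<rho>1 by (auto simp: \<rho>_def)
  have ann: "norm x < \<rho>" if "x \<in> ball 0 1" "\<zeta> \<in> S" "norm (f x - z \<zeta>) = r0" "\<tau> \<zeta> \<bullet> (f x - z \<zeta>) \<ge> 0"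
     "psi \<zeta> (f x) \<ge> 0" for x \<zeta> using \<rho>'(3)[OF that] by (simp add: \<rho>_def)
  define M where "M = 2 * (c2 * r0) / (1 - \<rho>\<^sup>2)"
  have "\<rho>\<^sup>2 < 1" using \<rho> by (simp add: power_less_one_iff)
  then have M: "M > 0" using c2 r0 by (simp add: M_def)
  have psiM: "psi \<zeta> (f x) \<le> M * (1 - (norm x)\<^sup>2)"
    if "x \<in> ball 0 1" "\<rho> \<le> norm x" "\<zeta> \<in> S" "norm (f x - z \<zeta>) \<le> r0" "\<tau> \<zeta> \<bullet> (f x - z \<zeta>) \<ge> 0" for x \<zeta>
    unfolding M_def by (rule psi_le_boundary_distance[OF \<rho>(1,2) ann that])
  define n where "n = real CARD('n)"
  have n: "n > 0" by (simp add: n_def)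
  define a where "a = (24 + 4 * n) / (\<kappa> * (c1 / 2)\<^sup>2)"
  \<comment> \<open>With \<open>\<epsilon> = s^2\<close> the error term becomes
    \<open>n * s^2\<close>, half of the admissible \<open>2 * n * s^2\<close>. The approximation
    error \<open>e\<close> is then taken with \<open>2 * e^2 \<le> \<delta>\<close>.\<close>
  define \<delta> where "\<delta> = n / (24 + 4 * n)"
  have \<delta>: "\<delta> > 0" using n by (simp add: \<delta>_def)
  define e where "e = min 1 (sqrt (\<delta> / 2))"
  have e: "e > 0" "e \<le> 1" using \<delta> by (auto simp: e_def)
  have "e\<^sup>2 \<le> (sqrt (\<delta> / 2))\<^sup>2" using e by (intro power_mono) (auto simp: e_def)
  then have e2: "2 * e\<^sup>2 \<le> \<delta>" using \<delta> by simp
  \<comment> \<open>Solves \<open>q - (1 - q) / 2 = \<rho>\<close>: for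
    \<open>norm x0 \<ge> q\<close> the small ball about \<open>x0\<close> stays at radius at least
    \<open>\<rho>\<close>.\<close>
  define q where "q = (2 * \<rho> + 1) / 3"
  have q: "q < 1" using \<rho> by (simp add: q_def)
  have outer: "norm (P k x0) \<le> a * (6 * M)\<^sup>2 + 3" if x0: "x0 \<in> ball 0 1" "q \<le> norm x0" for x0 k
  proof -
    define s where "s = (1 - norm x0) / 2"
    have s: "s > 0" "\<rho> \<le> norm x0 - s" using x0 by (auto simp: s_def q_def field_simps)
    have "norm x0 + s < 1" using x0 by (simp add: s_def field_simps)
    from difference_quotient_uniform[OF this e(1), of k]
    obtain d where d: "d > 0" "\<And>h x. h \<noteq> 0 \<Longrightarrow> \<bar>h\<bar> < d \<Longrightarrow> x \<in> cball 0 (norm x0 + s) \<Longrightarrow>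
        norm ((1 / h) *\<^sub>R (f (x + h *\<^sub>R axis k 1) - f x) - P k x) \<le> e" by blast
    define h where "h = min s d / 2"
    have h: "\<bar>h\<bar> < s" "h \<noteq> 0" "\<bar>h\<bar> < d" using s d by (auto simp: h_def)
    define G where "G x = (1 / h) *\<^sub>R (f (x + h *\<^sub>R axis k 1) - f x)" for x
    have GP: "norm (G x - P k x) \<le> e" if "x \<in> cball x0 s" for x
    proof -
      have "norm x \<le> norm x0 + s"
        using that norm_triangle_sub[of x x0] by (simp add: dist_norm norm_minus_commute)
      then show ?thesis unfolding G_def by (intro d(2) h) simp
    qed
    have G2: "(norm (G x))\<^sup>2 \<le> 2 * (\<Sum>i\<in>UNIV. (norm (P i x))\<^sup>2) + \<delta>" if "x \<in> cball x0 s" for x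
    proof -
      have "norm (G x) \<le> norm (P k x) + e" using GP[OF that] norm_triangle_sub[of "G x" "P k x"] by simp
      then have "(norm (G x))\<^sup>2 \<le> (norm (P k x) + e)\<^sup>2" by (intro power_mono) auto
      also have "\<dots> \<le> 2 * (norm (P k x))\<^sup>2 + 2 * e\<^sup>2"
        using zero_le_power2[of "norm (P k x) - e"] by (simp add: power2_eq_square algebra_simps)
      also have "(norm (P k x))\<^sup>2 \<le> (\<Sum>i\<in>UNIV. (norm (P i x))\<^sup>2)"
        by (rule member_le_sum) auto
      finally show ?thesis using e2 by simp
    qed
    have "(24 + 4 * n) * s\<^sup>2 * \<delta> = n * s\<^sup>2" using n by (simp add: \<delta>_def)
    also have "\<dots> < 2 * n * s\<^sup>2" using n s by simp
    finally have \<delta>s: "(24 + 4 * real CARD('n)) * s\<^sup>2 * \<delta> < 2 * real CARD('n) * s\<^sup>2" by (simp add: n_def)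
    have "s ^ 4 * (norm (G x0))\<^sup>2 \<le> a * s\<^sup>2 * (6 * M * s)\<^sup>2 + s\<^sup>2 * s\<^sup>2"
      unfolding G_def
      by (rule difference_quotient_bound[OF \<rho>(3) ann M psiM x0(1) s_def s(2) h(1,2) _ \<delta>s])
         (use s G2 in \<open>auto simp: a_def n_def G_def\<close>)
    also have "\<dots> = s ^ 4 * (a * (6 * M)\<^sup>2 + 1)"
      by (simp add: power_mult_distrib algebra_simps power4_eq_xxxx power2_eq_square)
    finally have "(norm (G x0))\<^sup>2 \<le> a * (6 * M)\<^sup>2 + 1" using s by simp
    \<comment> \<open>\<open>t \<le> t^2 + 1\<close> takes the place of a square root. This 1, the 1
      in the previous bound and \<open>e \<le> 1\<close> add up to the 3.\<close>
    moreover have "norm (G x0) \<le> (norm (G x0))\<^sup>2 + 1"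
      using zero_le_power2[of "norm (G x0) - 1 / 2"] by (simp add: power2_eq_square algebra_simps)
    moreover have "norm (P k x0) \<le> norm (G x0) + e"
      using GP[of x0] s norm_triangle_sub[of "P k x0" "G x0"] by (simp add: norm_minus_commute)
    ultimately show ?thesis using e by linarith
  qed
  have "continuous_on (cball 0 q) (\<lambda>x. \<Sum>k\<in>UNIV. norm (P k x))"
    using q by (intro continuous_intros continuous_on_subset[OF cont_P]) auto
  then have "bounded ((\<lambda>x. \<Sum>k\<in>UNIV. norm (P k x)) ` cball 0 q)"
    by (intro compact_imp_bounded compact_continuous_image) auto
  then obtain L where L: "\<And>x. x \<in> cball 0 q \<Longrightarrow> (\<Sum>k\<in>UNIV. norm (P k x)) \<le> L"
    unfolding bounded_iff by (metis abs_le_D1 imageI real_norm_def)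
  have inner: "norm (P k x) \<le> L" if "x \<in> cball 0 q" for k x
    using L[OF that] member_le_sum[of k UNIV "\<lambda>k. norm (P k x)"] by simp
  show ?thesis
  proof (intro exI[of _ "max L (a * (6 * M)\<^sup>2 + 3)"] ballI allI)
    fix x k assume "x \<in> ball (0::real^'n) 1"
    then show "norm (P k x) \<le> max L (a * (6 * M)\<^sup>2 + 3)"
      using outer[of x k] inner[of x k] by (cases "norm x \<le> q") (auto simp: le_max_iff_disj)
  qed
qed

theorem lipschitz_on_ball: "\<exists>L. L-lipschitz_on (ball 0 1) f"
proof -
  obtain L where L: "\<And>x k. x \<in> ball 0 1 \<Longrightarrow> norm (P k x) \<le> L" using partial_derivatives_bounded by blast
  have "L \<ge> 0" by (rule order_trans[OF norm_ge_zero L[of 0]]) simp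
  have "(real CARD('n) * L)-lipschitz_on (ball 0 1) f"
  proof (rule bounded_derivative_imp_lipschitz)
    fix x assume x: "x \<in> ball (0::real^'n) 1"
    show "(f has_derivative (\<lambda>h. \<Sum>i\<in>UNIV. (h $ i) *\<^sub>R P i x)) (at x within ball 0 1)"
      using deriv[OF x] by (rule has_derivative_at_withinI)
    show "onorm (\<lambda>h. \<Sum>i\<in>UNIV. (h $ i) *\<^sub>R P i x) \<le> real CARD('n) * L"
    proof (rule onorm_bound)
      fix h :: "real^'n"
      have "norm (\<Sum>i\<in>UNIV. (h $ i) *\<^sub>R P i x) \<le> (\<Sum>i\<in>(UNIV::'n set). norm h * L)"
        using component_le_norm_cart[of h] L[OF x] \<open>L \<ge> 0\<close>
        by (intro order_trans[OF norm_sum] sum_mono) (auto intro!: mult_mono)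
      then show "norm (\<Sum>i\<in>UNIV. (h $ i) *\<^sub>R P i x) \<le> real CARD('n) * L * norm h"
        by (simp add: mult_ac)
    qed (use \<open>L \<ge> 0\<close> in auto)
  qed (use \<open>L \<ge> 0\<close> in auto)
  then show ?thesis by blast
qed

end

subsection \<open>Domains with Hoelder continuously differentiable boundary\<close>

lemma powr_le_near_zero:
  fixes a e :: real
  assumes "a > 0" "e > 0"
  shows "\<exists>d>0. \<forall>r. 0 \<le> r \<longrightarrow> r \<le> d \<longrightarrow> r powr a \<le> e"
proof (intro exI[of _ "e powr (1 / a)"] conjI allI impI)
  fix r :: real assume "0 \<le> r" "r \<le> e powr (1 / a)"
  then have "r powr a \<le> (e powr (1 / a)) powr a" using assms by (intro powr_mono2) auto
  then show "r powr a \<le> e" using assms by (simp add: powr_powr)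
qed (use assms in simp)

text \<open>The mean value inequality on the segment from \<open>x\<close> to \<open>y\<close>,
  along which the derivative differs from \<open>DG x\<close> by at most
  \<open>C * norm (y - x) powr \<alpha>\<close>.\<close>

lemma C1_Holder_remainder:
  fixes G :: "'a::real_normed_vector \<Rightarrow> 'b::real_normed_vector" and DG :: "'a \<Rightarrow> 'a \<Rightarrow>\<^sub>L 'b"
  assumes T: "convex T"
    and der: "\<And>x. x \<in> T \<Longrightarrow> (G has_derivative blinfun_apply (DG x)) (at x within T)"
    and hold: "\<And>x y. \<lbrakk>x \<in> T; y \<in> T\<rbrakk> \<Longrightarrow> dist (DG x) (DG y) \<le> C * dist x y powr \<alpha>"
    and "C \<ge> 0" "\<alpha> > 0" and xy: "x \<in> T" "y \<in> T"
  shows "norm (G y - G x - DG x (y - x)) \<le> C * norm (y - x) powr (1 + \<alpha>)"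
proof -
  have "norm (G y - G x - DG x (y - x)) \<le> norm (y - x) * (C * norm (y - x) powr \<alpha>)"
  proof (rule differentiable_bound_linearization[of x y "closed_segment x y" G "\<lambda>v. blinfun_apply (DG v)"])
    fix v assume v: "v \<in> closed_segment x y"
    have vT: "v \<in> T" using v xy closed_segment_subset[OF xy T] by blast
    show "(G has_derivative blinfun_apply (DG v)) (at v within closed_segment x y)"
      using has_derivative_subset[OF der[OF vT] closed_segment_subset[OF xy T]] .
    have "onorm (\<lambda>w. blinfun_apply (DG v) w - blinfun_apply (DG x) w) = dist (DG v) (DG x)"
      by (simp add: dist_norm norm_blinfun.rep_eq minus_blinfun.rep_eq)
    also have "\<dots> \<le> C * norm (v - x) powr \<alpha>" using hold[OF vT xy(1)] by (simp add: dist_norm)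
    also have "\<dots> \<le> C * norm (y - x) powr \<alpha>"
      using \<open>C \<ge> 0\<close> \<open>\<alpha> > 0\<close> segment_bound(1)[OF v] by (intro mult_left_mono powr_mono2) auto
    finally show "onorm (blinfun_apply (DG v) - blinfun_apply (DG x)) \<le> C * norm (y - x) powr \<alpha>"
      by (simp add: fun_diff_def)
  next
    show "x + t *\<^sub>R (y - x) \<in> closed_segment x y" if "t \<in> {0..1}" for t
      using that by (auto simp: in_segment algebra_simps intro!: exI[of _ t])
  qed auto
  also have "norm (y - x) * (C * norm (y - x) powr \<alpha>) = C * norm (y - x) powr (1 + \<alpha>)"
    by (cases "y = x") (auto simp: powr_add)
  finally show ?thesis .
qed

text \<open>At boundary points derivatives within a set need not be unique in general, so the chain rule is
  used inside the ball and extended by continuity.\<close>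

lemma derivative_of_inverse_on_closed_ball:
  fixes G H :: "'a::euclidean_space \<Rightarrow> 'a" and DG DH :: "'a \<Rightarrow> 'a \<Rightarrow>\<^sub>L 'a"
  assumes \<Omega>: "open \<Omega>" "G ` ball 0 1 = \<Omega>"
    and hom: "homeomorphism (cball 0 1) (closure \<Omega>) G H"
    and DG: "\<And>x. x \<in> cball 0 1 \<Longrightarrow> (G has_derivative blinfun_apply (DG x)) (at x within cball 0 1)"
      "continuous_on (cball 0 1) DG"
    and DH: "\<And>y. y \<in> closure \<Omega> \<Longrightarrow> (H has_derivative blinfun_apply (DH y)) (at y within closure \<Omega>)"
      "continuous_on (closure \<Omega>) DH"
    and \<zeta>: "\<zeta> \<in> cball 0 1"
  shows "DH (G \<zeta>) (DG \<zeta> v) = v"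
proof -
  have GH: "H (G x) = x" if "x \<in> cball 0 1" for x using hom that by (simp add: homeomorphism_def)
  have Gc: "continuous_on (cball 0 1) G" "G ` cball 0 1 = closure \<Omega>" using hom by (auto simp: homeomorphism_def)
  have inside: "blinfun_apply (DH (G x)) (blinfun_apply (DG x) v) = v" if x: "x \<in> ball 0 1" for x
  proof -
    have "G x \<in> interior (closure \<Omega>)"
      using \<Omega> x interior_mono[OF closure_subset[of \<Omega>]] interior_open by blast
    then have h: "(H has_derivative blinfun_apply (DH (G x))) (at (G x))"
      using DH(1)[of "G x"] by (metis at_within_interior interior_subset subsetD)
    have "x \<in> interior (cball 0 1)" using x by simp
    then have g: "(G has_derivative blinfun_apply (DG x)) (at x)"
      using DG(1)[of x] by (metis at_within_interior interior_subset subsetD)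
    have "((\<lambda>x. H (G x)) has_derivative (\<lambda>v. DH (G x) (DG x v))) (at x)"
      by (rule has_derivative_compose[OF g h])
    then have "((\<lambda>x. x) has_derivative (\<lambda>v. DH (G x) (DG x v))) (at x)"
      by (rule has_derivative_transform_within_open[of _ _ _ _ "ball 0 1"]) (use x GH in auto)
    then have "(\<lambda>v. DH (G x) (DG x v)) = (\<lambda>v. v)"
      using has_derivative_ident has_derivative_unique by blast
    then show ?thesis by metis
  qed
  have "continuous_on (closure (ball 0 1)) (\<lambda>x. blinfun_apply (DH (G x)) (blinfun_apply (DG x) v))"
    using Gc DG(2) by (auto intro!: continuous_intros continuous_on_compose2[OF DH(2)])
  then show ?thesis by (rule continuous_constant_on_closure) (use inside \<zeta> in auto)
qed

lemma compact_subset_ball_norm_bound: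
  fixes K :: "'a::real_normed_vector set"
  assumes "compact K" "K \<subseteq> ball 0 1"
  shows "\<exists>\<rho><1. \<forall>x\<in>K. norm x < \<rho>"
proof (cases "K = {}")
  case False
  have "continuous_on K norm" by (intro continuous_intros)
  then obtain y where y: "y \<in> K" "\<And>x. x \<in> K \<Longrightarrow> norm x \<le> norm y"
    using continuous_attains_sup[OF assms(1) False] by blast
  have "norm y < 1" using y assms by auto
  with y show ?thesis by (intro exI[of _ "(1 + norm y) / 2"]) force
qed (auto intro: exI[of _ 0])

text \<open>A homeomorphism is proper: continuity of \<open>g\<close> at a cluster value inside
  \<open>\<Omega>\<close> would make the approximating points converge to a point of the open ball
  instead of to the sphere.\<close>

lemma closure_graph_at_sphere:
  fixes f :: "'a::real_normed_vector \<Rightarrow> 'b::real_normed_vector"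
  assumes hom: "homeomorphism (ball 0 1) \<Omega> f g" and "open \<Omega>"
    and cl: "(x, y) \<in> closure ((\<lambda>x. (x, f x)) ` ball 0 1)" and x: "norm x = 1"
  shows "y \<in> closure \<Omega> - \<Omega>"
proof -
  obtain v where v: "\<And>n. v n \<in> (\<lambda>x. (x, f x)) ` ball 0 1" "v \<longlonglongrightarrow> (x, y)"
    using cl by (auto simp: closure_sequential)
  then have lim: "(\<lambda>n. fst (v n)) \<longlonglongrightarrow> x" "(\<lambda>n. snd (v n)) \<longlonglongrightarrow> y"
    using tendsto_fst tendsto_snd by fastforce+
  have vn: "fst (v n) \<in> ball 0 1" "snd (v n) = f (fst (v n))" for n using v(1)[of n] by auto
  have vO: "snd (v n) \<in> \<Omega>" "g (snd (v n)) = fst (v n)" for n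
    using vn[of n] hom by (auto simp: homeomorphism_def)
  have "y \<in> closure \<Omega>"
    unfolding closure_sequential by (intro exI[of _ "\<lambda>n. snd (v n)"] conjI allI lim(2) vO(1))
  moreover have "y \<notin> \<Omega>"
  proof
    assume y: "y \<in> \<Omega>"
    then have "isCont g y"
      using hom \<open>open \<Omega>\<close> by (simp add: homeomorphism_def continuous_on_eq_continuous_at)
    then have "(\<lambda>n. g (snd (v n))) \<longlonglongrightarrow> g y" using lim(2) isCont_tendsto_compose by blast
    then have "g y = x" using lim(1) vO(2) LIMSEQ_unique by auto
    moreover have "g y \<in> ball 0 1" using y hom by (auto simp: homeomorphism_def)
    ultimately show False using x by simp
  qed
  ultimately show ?thesis by simp
qed

theorem theorem1p1:
  fixes \<Omega> :: "(real^'n) set" and f :: "real^'n \<Rightarrow> real^'n" and \<alpha> :: real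
  assumes "CARD('n) > 1"
    and "0 < \<alpha>" and "\<alpha> \<le> 1"
    and "domain \<Omega>" and "C1_Holder_boundary \<alpha> \<Omega>"
    and "harmonic_mapping_on (ball 0 1) f"
    and "f ` ball 0 1 = \<Omega>"
    and "\<exists>K\<ge>1. K_quasiconformal K (ball 0 1) \<Omega> f"
  shows "\<exists>L. lipschitz_on L (ball 0 1) f"
proof -

  \<comment> \<open>Constants of the boundary diffeomorphism\<close>
  obtain K where K: "K \<ge> 1" "K_quasiconformal K (ball 0 1) \<Omega> f" using assms(8) by blast
  define \<kappa> where "\<kappa> = 1 / (real CARD('n) * K\<^sup>2)"
  obtain P P2 where "harmonic_qc f P P2 \<kappa>" using harmonic_qcI[OF assms(6) K(2)] by (auto simp: \<kappa>_def)
  then interpret harmonic_qc f P P2 \<kappa> .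
  obtain g where hom_f: "homeomorphism (ball 0 1) \<Omega> f g" using K by (auto simp: K_quasiconformal_def)
  have open_\<Omega>: "open \<Omega>" using assms(4) by (simp add: domain_def)
  obtain G :: "real^'n \<Rightarrow> real^'n" and H where hom: "homeomorphism (cball 0 1) (closure \<Omega>) G H"
    and G\<Omega>: "G ` ball 0 1 = \<Omega>" and G1: "C1_Holder_on \<alpha> (cball 0 1) G" and H1: "C1_Holder_on \<alpha> (closure \<Omega>) H"
    using assms(5) by (auto simp: C1_Holder_boundary_def C1_Holder_diffeomorphism_def)
  obtain DG C' where DG: "\<And>x. x \<in> cball 0 1 \<Longrightarrow> (G has_derivative blinfun_apply (DG x)) (at x within cball 0 1)"
      "continuous_on (cball 0 1) DG"
    and C': "\<And>x y. \<lbrakk>x \<in> cball 0 1; y \<in> cball 0 1\<rbrakk> \<Longrightarrow> dist (DG x) (DG y) \<le> C' * dist x y powr \<alpha>"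
    using G1 unfolding C1_Holder_on_def Holder_on_def by blast
  obtain DH where DH: "\<And>y. y \<in> closure \<Omega> \<Longrightarrow> (H has_derivative blinfun_apply (DH y)) (at y within closure \<Omega>)"
      "continuous_on (closure \<Omega>) DH"
    using H1 unfolding C1_Holder_on_def by blast
  have GH: "H (G x) = x" "G x \<in> closure \<Omega>" if "x \<in> cball 0 1" for x
    using hom that by (auto simp: homeomorphism_def)
  have HG: "G (H y) = y" "H y \<in> cball 0 1" if "y \<in> closure \<Omega>" for y
    using hom that by (auto simp: homeomorphism_def)
  have Gc: "continuous_on (cball 0 1) G" and Gim: "G ` cball 0 1 = closure \<Omega>"
    and Hc: "continuous_on (closure \<Omega>) H" using hom by (auto simp: homeomorphism_def)
  have compact_\<Omega>: "compact (closure \<Omega>)" using compact_continuous_image[OF Gc] Gim by simp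
  have inv: "DH (G \<zeta>) (DG \<zeta> v) = v" if "\<zeta> \<in> cball 0 1" for \<zeta> v
    by (rule derivative_of_inverse_on_closed_ball[OF open_\<Omega> G\<Omega> hom DG DH that])
  \<comment> \<open>Truncation at 0 makes the Hoelder constant usable as a nonnegative
    factor.\<close>
  define CG where "CG = max C' 0"
  have CG: "CG \<ge> 0" by (simp add: CG_def)
  have Hold: "dist (DG x) (DG y) \<le> CG * dist x y powr \<alpha>" if "x \<in> cball 0 1" "y \<in> cball 0 1" for x y
    by (rule order_trans[OF C'[OF that]]) (simp add: CG_def mult_right_mono)
  define \<beta> where "\<beta> = 1 + \<alpha>"
  have \<beta>: "1 < \<beta>" "\<beta> \<le> 2" using assms by (auto simp: \<beta>_def)
  have taylor: "norm (G \<eta> - G \<zeta> - DG \<zeta> (\<eta> - \<zeta>)) \<le> CG * norm (\<eta> - \<zeta>) powr \<beta>"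
    if "\<zeta> \<in> cball 0 1" "\<eta> \<in> cball 0 1" for \<zeta> \<eta>
    unfolding \<beta>_def by (rule C1_Holder_remainder[OF convex_cball DG(1) Hold CG assms(2) that])
  obtain MG where MG: "MG > 0" "\<And>x. x \<in> cball 0 1 \<Longrightarrow> norm (DG x) \<le> MG"
    using compact_imp_bounded[OF compact_continuous_image[OF DG(2) compact_cball]]
    by (auto simp: bounded_pos)
  obtain MH where MH: "MH > 0" "\<And>y. y \<in> closure \<Omega> \<Longrightarrow> norm (DH y) \<le> MH"
    using compact_imp_bounded[OF compact_continuous_image[OF DH(2) compact_\<Omega>]]
    by (auto simp: bounded_pos)
  have DHle: "norm (DH (G \<zeta>) v) \<le> MH * norm v" if "\<zeta> \<in> cball 0 1" for \<zeta> v
    using norm_blinfun[of "DH (G \<zeta>)" v] MH(2)[OF GH(2)[OF that]]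
    by (meson mult_right_mono norm_ge_zero order_trans)
  have DGle: "norm (DG \<zeta> v) \<le> MG * norm v" if "\<zeta> \<in> cball 0 1" for \<zeta> v
    using norm_blinfun[of "DG \<zeta>" v] MG(2)[OF that] by (meson mult_right_mono norm_ge_zero order_trans)

  \<comment> \<open>minus the gradient at \<open>G \<zeta>\<close> of \<open>\<zeta> \<bullet> H\<close>\<close>
  define \<tau> :: "real^'n \<Rightarrow> real^'n" where "\<tau> \<zeta> = (\<chi> i. - (\<zeta> \<bullet> DH (G \<zeta>) (axis i 1)))" for \<zeta>
  have \<tau>: "\<tau> \<zeta> \<bullet> p = - (\<zeta> \<bullet> DH (G \<zeta>) p)" for \<zeta> p
  proof -
    have "DH (G \<zeta>) p = DH (G \<zeta>) (\<Sum>i\<in>UNIV. p $ i *s axis i 1)" by (simp add: basis_expansion)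
    also have "\<dots> = (\<Sum>i\<in>UNIV. (p $ i) *\<^sub>R DH (G \<zeta>) (axis i 1))"
      by (simp add: blinfun.sum_right scalar_mult_eq_scaleR blinfun.scaleR_right)
    finally have "\<zeta> \<bullet> DH (G \<zeta>) p = (\<Sum>i\<in>UNIV. p $ i * (\<zeta> \<bullet> DH (G \<zeta>) (axis i 1)))"
      by (simp add: inner_sum_right)
    moreover have "\<tau> \<zeta> \<bullet> p = - (\<Sum>i\<in>UNIV. p $ i * (\<zeta> \<bullet> DH (G \<zeta>) (axis i 1)))"
      by (subst inner_vec_def) (simp add: \<tau>_def sum_negf mult.commute)
    ultimately show ?thesis by simp
  qed
  have sub: "sphere 0 1 \<subseteq> (cball 0 1 :: (real^'n) set)" by auto
  have \<tau>c: "continuous_on (sphere 0 1) \<tau>"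
  proof -
    have "continuous_on (sphere 0 1) (\<lambda>\<zeta>. DH (G \<zeta>))"
      using continuous_on_subset[OF Gc sub] Gim by (auto intro!: continuous_on_compose2[OF DH(2)])
    then show ?thesis unfolding \<tau>_def
      by (intro continuous_on_vec_lambda continuous_intros)
  qed
  have \<tau>_upper: "norm (\<tau> \<zeta>) \<le> MH" if "\<zeta> \<in> sphere 0 1" for \<zeta>
  proof -
    have "(norm (\<tau> \<zeta>))\<^sup>2 = - (\<zeta> \<bullet> DH (G \<zeta>) (\<tau> \<zeta>))" by (simp add: power2_norm_eq_inner \<tau>)
    also have "\<dots> \<le> norm \<zeta> * norm (DH (G \<zeta>) (\<tau> \<zeta>))"
      using Cauchy_Schwarz_ineq2[of \<zeta> "DH (G \<zeta>) (\<tau> \<zeta>)"] by linarith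
    also have "\<dots> \<le> MH * norm (\<tau> \<zeta>)" using DHle[of \<zeta> "\<tau> \<zeta>"] that by simp
    finally show ?thesis using MH by (cases "\<tau> \<zeta> = 0") (auto simp: power2_eq_square)
  qed
  \<comment> \<open>Test against \<open>- DG \<zeta> \<zeta>\<close>, the image of the inward radial
    direction: \<open>DH\<close> undoes \<open>DG\<close>, so the pairing is
    \<open>\<zeta> \<bullet> \<zeta> = 1\<close>.\<close>
  have \<tau>_lower: "1 / MG \<le> norm (\<tau> \<zeta>)" if "\<zeta> \<in> sphere 0 1" for \<zeta>
  proof -
    have "1 = \<tau> \<zeta> \<bullet> (- DG \<zeta> \<zeta>)" using that inv[of \<zeta> \<zeta>] by (simp add: \<tau> blinfun.minus_right dot_square_norm)
    also have "\<dots> \<le> norm (\<tau> \<zeta>) * norm (DG \<zeta> \<zeta>)" using norm_cauchy_schwarz[of "\<tau> \<zeta>" "- DG \<zeta> \<zeta>"] by simp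
    also have "\<dots> \<le> norm (\<tau> \<zeta>) * MG" using DGle[of \<zeta> \<zeta>] that by (intro mult_left_mono) auto
    finally show ?thesis using MG by (simp add: divide_le_eq)
  qed
  \<comment> \<open>The closure of \<open>\<Omega>\<close> need not be convex, so the expansion is
    taken for \<open>G\<close> on the ball and carried back by \<open>DH (G \<zeta>)\<close>, a left
    inverse of \<open>DG \<zeta>\<close>.\<close>
  have \<tau>_expand: "\<bar>\<tau> \<zeta> \<bullet> (G \<eta> - G \<zeta>) - \<zeta> \<bullet> (\<zeta> - \<eta>)\<bar> \<le> MH * CG * norm (\<eta> - \<zeta>) powr \<beta>"
    if \<zeta>: "\<zeta> \<in> sphere 0 1" and \<eta>: "\<eta> \<in> cball 0 1" for \<zeta> \<eta>
  proof -
    have \<zeta>c: "\<zeta> \<in> cball 0 1" using \<zeta> by simp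
    define R where "R = G \<eta> - G \<zeta> - DG \<zeta> (\<eta> - \<zeta>)"
    have "G \<eta> - G \<zeta> = DG \<zeta> (\<eta> - \<zeta>) + R" by (simp add: R_def)
    then have eq: "DH (G \<zeta>) (G \<eta> - G \<zeta>) = (\<eta> - \<zeta>) + DH (G \<zeta>) R"
      using inv[OF \<zeta>c] by (simp add: blinfun.add_right)
    have "\<tau> \<zeta> \<bullet> (G \<eta> - G \<zeta>) - \<zeta> \<bullet> (\<zeta> - \<eta>) = - (\<zeta> \<bullet> DH (G \<zeta>) R)"
      unfolding \<tau> eq by (simp add: inner_add_right inner_diff_right)
    then have "\<bar>\<tau> \<zeta> \<bullet> (G \<eta> - G \<zeta>) - \<zeta> \<bullet> (\<zeta> - \<eta>)\<bar> \<le> norm \<zeta> * norm (DH (G \<zeta>) R)"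
      using Cauchy_Schwarz_ineq2[of \<zeta> "DH (G \<zeta>) R"] by simp
    also have "\<dots> \<le> MH * norm R" using DHle[OF \<zeta>c, of R] \<zeta> by simp
    also have "\<dots> \<le> MH * (CG * norm (\<eta> - \<zeta>) powr \<beta>)"
      using taylor[OF \<zeta>c \<eta>] MH by (intro mult_left_mono) (auto simp: R_def)
    finally show ?thesis by simp
  qed

  \<comment> \<open>At this scale the remainder is at most half of the linear term and can be
    absorbed. The added 1 keeps the denominator positive for \<open>CG = 0\<close>.\<close>
  obtain \<delta>' where \<delta>': "\<delta>' > 0" "\<And>r. 0 \<le> r \<Longrightarrow> r \<le> \<delta>' \<Longrightarrow> r powr \<alpha> \<le> 1 / (2 * (MH * CG + 1))"
    using powr_le_near_zero[OF assms(2), of "1 / (2 * (MH * CG + 1))"] MH CG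
    by (auto simp: add_nonneg_pos)
  define \<delta> where "\<delta> = min \<delta>' (1 / 2)"
  have \<delta>: "\<delta> > 0" "\<delta> \<le> 1 / 2" using \<delta>' by (auto simp: \<delta>_def)
  have small: "MH * CG * r powr \<beta> \<le> r / 2" "r powr \<beta> \<le> r" if "0 \<le> r" "r \<le> \<delta>" for r
  proof -
    have rb: "r powr \<beta> = r * r powr \<alpha>" using that by (cases "r = 0") (auto simp: \<beta>_def powr_add)
    have MC: "MH * CG \<ge> 0" using MH CG by simp
    have "MH * CG * r powr \<alpha> \<le> (MH * CG + 1) * (1 / (2 * (MH * CG + 1)))"
      using \<delta>'(2)[of r] that MC by (intro mult_mono) (auto simp: \<delta>_def)
    also have "\<dots> = 1 / 2" using MC by (simp add: field_simps)
    finally have "r * (MH * CG * r powr \<alpha>) \<le> r * (1 / 2)" using that by (intro mult_left_mono) auto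
    then show "MH * CG * r powr \<beta> \<le> r / 2" by (simp add: rb mult_ac)
    have "r powr \<alpha> \<le> 1 powr \<alpha>" using that \<delta> assms(2) by (intro powr_mono2) auto
    then have "r * r powr \<alpha> \<le> r * 1" using that by (intro mult_left_mono) auto
    then show "r powr \<beta> \<le> r" by (simp add: rb)
  qed
  \<comment> \<open>Closeness of image points has to imply closeness of the parameters, so that
    \<open>small\<close> applies to them.\<close>
  have "uniformly_continuous_on (closure \<Omega>) H" by (rule compact_uniformly_continuous[OF Hc compact_\<Omega>])
  then obtain r1 where r1: "r1 > 0" "\<And>y y'. y \<in> closure \<Omega> \<Longrightarrow> y' \<in> closure \<Omega> \<Longrightarrow> dist y' y < r1 \<Longrightarrow> dist (H y') (H y) < \<delta>"
    unfolding uniformly_continuous_on_def using \<delta> by metis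
  \<comment> \<open>\<open>1 / 2\<close> accounts for the curvature of the sphere and
    \<open>MH * CG\<close> for the remainder; \<open>2 * MH\<close> bounds the distance of
    parameters by that of their images.\<close>
  define C0 where "C0 = (1 / 2 + MH * CG) * (2 * MH) powr \<beta>"
  have C0: "C0 \<ge> 0" using MH CG by (simp add: C0_def)
  have bdry: "\<tau> \<zeta> \<bullet> (G \<xi> - G \<zeta>) \<le> C0 * norm (G \<xi> - G \<zeta>) powr \<beta>"
    if \<zeta>: "\<zeta> \<in> sphere 0 1" and \<xi>: "\<xi> \<in> sphere 0 1" and d: "norm (G \<xi> - G \<zeta>) < r1" for \<zeta> \<xi>
  proof -
    have cb: "\<zeta> \<in> cball 0 1" "\<xi> \<in> cball 0 1" using \<zeta> \<xi> by auto
    define r where "r = norm (\<xi> - \<zeta>)"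
    have r: "0 \<le> r" "r \<le> \<delta>" using r1(2)[of "G \<zeta>" "G \<xi>"] GH cb d by (auto simp: r_def dist_norm)
    have "r = norm (DH (G \<zeta>) (DG \<zeta> (\<xi> - \<zeta>)))" by (simp add: inv[OF cb(1)] r_def)
    also have "\<dots> \<le> MH * norm (DG \<zeta> (\<xi> - \<zeta>))" by (rule DHle[OF cb(1)])
    also have "norm (DG \<zeta> (\<xi> - \<zeta>)) \<le> norm (G \<xi> - G \<zeta>) + CG * r powr \<beta>"
      using taylor[OF cb] norm_triangle_ineq4[of "G \<xi> - G \<zeta>" "G \<xi> - G \<zeta> - DG \<zeta> (\<xi> - \<zeta>)"]
      by (simp add: r_def)
    finally have "r \<le> MH * norm (G \<xi> - G \<zeta>) + MH * CG * r powr \<beta>"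
      using MH by (simp add: distrib_left mult.assoc)
    with small(1)[OF r] have r2: "r \<le> 2 * MH * norm (G \<xi> - G \<zeta>)" by simp
    \<comment> \<open>The sphere leaves its tangent plane quadratically; as \<open>r \<le> 1\<close>
      and \<open>\<beta> \<le> 2\<close>, the exponent 2 may be lowered to
      \<open>\<beta>\<close>.\<close>
    have "\<zeta> \<bullet> \<zeta> = 1" "\<xi> \<bullet> \<xi> = 1" using \<zeta> \<xi> by (simp_all add: dot_square_norm)
    moreover have "r\<^sup>2 = (\<xi> - \<zeta>) \<bullet> (\<xi> - \<zeta>)" by (simp add: r_def power2_norm_eq_inner)
    ultimately have "\<zeta> \<bullet> (\<zeta> - \<xi>) = r\<^sup>2 / 2"
      by (simp add: inner_diff_left inner_diff_right inner_commute)
    also have "r\<^sup>2 = r powr 2" using r by simp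
    also have "r powr 2 \<le> r powr \<beta>" using r \<delta> \<beta> by (intro powr_mono') auto
    finally have "\<tau> \<zeta> \<bullet> (G \<xi> - G \<zeta>) \<le> (1 / 2 + MH * CG) * r powr \<beta>"
      using \<tau>_expand[OF \<zeta> cb(2)] by (simp add: r_def abs_le_iff distrib_right)
    also have "\<dots> \<le> (1 / 2 + MH * CG) * (2 * MH * norm (G \<xi> - G \<zeta>)) powr \<beta>"
      using r r2 MH CG \<beta> by (intro mult_left_mono powr_mono2) auto
    also have "\<dots> = C0 * norm (G \<xi> - G \<zeta>) powr \<beta>" using MH by (simp add: C0_def powr_mult)
    finally show ?thesis .
  qed

  \<comment> \<open>\<open>c\<close> is the ratio of the estimates \<open>d / 2\<close> for the
    normal component and \<open>(MG + CG) * d\<close> for the distance, found below at depth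
    \<open>d\<close>. \<open>C\<close> exceeds \<open>2 * C0\<close>, and \<open>A\<close> gives
    equality in the largeness condition.\<close>
  define c1 where "c1 = 1 / MG"
  define c where "c = 1 / (2 * (MG + CG))"
  define C where "C = 2 * C0 + 1"
  define A where "A = C / ((\<beta> - 1) * \<kappa> * c1 powr \<beta>)"
  have pos: "c1 > 0" "c > 0" "C > 0" using MG CG C0 by (auto simp: c1_def c_def C_def add_pos_nonneg)
  have den: "(\<beta> - 1) * \<kappa> * c1 powr \<beta> > 0" using \<beta> \<kappa>_pos pos by simp
  have A: "A > 0" "A * (\<beta> - 1) * \<kappa> * c1 powr \<beta> = C" using den pos by (auto simp: A_def mult.assoc)
  \<comment> \<open>One entry for each of the three smallness conditions on \<open>r0\<close>, in
    which \<open>\<beta> - 1 = \<alpha>\<close>.\<close>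
  define e where "e = Min {1 / (A * MH powr \<alpha>), c1 / (2 * C * \<beta>), c / (2 * C)}"
  have e: "e > 0" "e \<le> 1 / (A * MH powr \<alpha>)" "e \<le> c1 / (2 * C * \<beta>)" "e \<le> c / (2 * C)"
    using A MH pos \<beta> by (auto simp: e_def)
  obtain r0' where r0': "r0' > 0" "\<And>r. 0 \<le> r \<Longrightarrow> r \<le> r0' \<Longrightarrow> r powr \<alpha> \<le> e"
    using powr_le_near_zero[OF assms(2) e(1)] by blast
  define r0 where "r0 = min r0' (r1 / 2)"
  have r0: "r0 > 0" "r0 < r1" "r0 powr \<alpha> \<le> e" using r0' r1(1) by (auto simp: r0_def)
  \<comment> \<open>Depth of a collar: if \<open>1 - norm \<eta> < \<epsilon>\<close>, then
    \<open>G \<eta>\<close> is within \<open>r0\<close> of the image of the radial projection of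
    \<open>\<eta>\<close>.\<close>
  define \<epsilon> where "\<epsilon> = min \<delta> (r0 / (2 * (MG + CG)))"
  have \<epsilon>: "\<epsilon> > 0" "\<epsilon> \<le> \<delta>" "\<epsilon> \<le> r0 / (2 * (MG + CG))" using \<delta> r0 MG CG by (auto simp: \<epsilon>_def)

  \<comment> \<open>The part of \<open>\<Omega>\<close> outside the collar has compact preimage
    under \<open>f\<close>, so \<open>norm x \<ge> \<rho>1\<close> forces \<open>f x\<close> into
    the collar.\<close>
  have "compact (g ` G ` cball 0 (1 - \<epsilon>))" "g ` G ` cball 0 (1 - \<epsilon>) \<subseteq> ball 0 1"
  proof -
    have s: "cball 0 (1 - \<epsilon>) \<subseteq> (ball 0 1 :: (real^'n) set)" using \<epsilon> by auto
    then have GO: "G ` cball 0 (1 - \<epsilon>) \<subseteq> \<Omega>" using G\<Omega> by blast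
    have "continuous_on \<Omega> g" "g ` \<Omega> = ball 0 1" using hom_f by (auto simp: homeomorphism_def)
    then show "compact (g ` G ` cball 0 (1 - \<epsilon>))" "g ` G ` cball 0 (1 - \<epsilon>) \<subseteq> ball 0 1"
      using GO s by (auto intro!: compact_continuous_image continuous_on_subset[OF Gc] intro: continuous_on_subset)
  qed
  from compact_subset_ball_norm_bound[OF this]
  obtain \<rho>1 where \<rho>1: "\<rho>1 < 1" "\<And>x. x \<in> g ` G ` cball 0 (1 - \<epsilon>) \<Longrightarrow> norm x < \<rho>1" by blast

  interpret harmonic_qc_barrier f P P2 \<kappa> "sphere 0 1" G \<tau> \<beta> c1 MH c C0 C A r0 \<rho>1
  proof unfold_locales
    show "A * (MH * r0) powr (\<beta> - 1) \<le> 1"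
    proof -
      have "A * (MH * r0) powr (\<beta> - 1) = A * MH powr \<alpha> * r0 powr \<alpha>"
        using MH r0 by (simp add: \<beta>_def powr_mult)
      also have "\<dots> \<le> A * MH powr \<alpha> * (1 / (A * MH powr \<alpha>))"
        using r0 e A by (intro mult_left_mono) auto
      also have "\<dots> = 1" using A MH by simp
      finally show ?thesis .
    qed
    show "C * \<beta> * r0 powr (\<beta> - 1) \<le> c1 / 2"
    proof -
      have "C * \<beta> * r0 powr (\<beta> - 1) \<le> C * \<beta> * (c1 / (2 * C * \<beta>))"
        using r0 e pos \<beta> by (intro mult_left_mono) (auto simp: \<beta>_def)
      also have "\<dots> = c1 / 2" using pos \<beta> by (simp add: field_simps)
      finally show ?thesis .
    qed
    show "C * r0 powr (\<beta> - 1) < c"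
    proof -
      have "C * r0 powr (\<beta> - 1) \<le> C * (c / (2 * C))"
        using r0 e pos by (intro mult_left_mono) (auto simp: \<beta>_def)
      also have "\<dots> = c / 2" using pos by (simp add: field_simps)
      also have "\<dots> < c" using pos by simp
      finally show ?thesis .
    qed
    show "\<exists>\<zeta>\<in>sphere 0 1. f x \<noteq> G \<zeta> \<and> norm (f x - G \<zeta>) < r0 \<and> c * norm (f x - G \<zeta>) \<le> \<tau> \<zeta> \<bullet> (f x - G \<zeta>)"
      if x: "x \<in> ball 0 1" "\<rho>1 \<le> norm x" for x
    proof -
      have "f x \<in> G ` ball 0 1" using imageI[OF x(1), of f] by (simp only: assms(7) G\<Omega>)
      then obtain \<eta> where "f x = G \<eta>" "\<eta> \<in> ball 0 1" by (rule imageE)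
      then have \<eta>: "\<eta> \<in> ball 0 1" "G \<eta> = f x" by auto
      have "g (f x) = x" using hom_f x by (auto simp: homeomorphism_def)
      then have "\<eta> \<notin> cball 0 (1 - \<epsilon>)" using \<rho>1(2)[of x] \<eta>(2) x(2) by force
      then have n\<eta>: "1 - \<epsilon> < norm \<eta>" by simp
      define d where "d = 1 - norm \<eta>"
      have d: "0 < d" "d < \<epsilon>" "0 \<le> d" "d \<le> \<delta>" using n\<eta> \<eta> \<epsilon> by (auto simp: d_def)
      have n0: "norm \<eta> > 0" using d(4) \<delta>(2) unfolding d_def by linarith
      \<comment> \<open>The radial projection of \<open>\<eta>\<close>: the displacement is purely
        normal, so the leading term in \<open>\<tau>_expand\<close> is the full depth
        \<open>d\<close>.\<close>
      define \<zeta> where "\<zeta> = (1 / norm \<eta>) *\<^sub>R \<eta>"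
      have \<zeta>: "\<zeta> \<in> sphere 0 1" using n0 by (simp add: \<zeta>_def)
      have \<eta>\<zeta>: "\<eta> = (1 - d) *\<^sub>R \<zeta>" using n0 by (simp add: \<zeta>_def d_def)
      then have diff: "\<eta> - \<zeta> = - d *\<^sub>R \<zeta>" by (simp add: scaleR_diff_left)
      then have nd: "norm (\<eta> - \<zeta>) = d" using \<zeta> d by simp
      have cb: "\<zeta> \<in> cball 0 1" "\<eta> \<in> cball 0 1" using \<zeta> \<eta> by auto
      have "\<zeta> \<bullet> (\<zeta> - \<eta>) = d"
      proof -
        have "\<zeta> - \<eta> = d *\<^sub>R \<zeta>" using diff by (metis minus_diff_eq scaleR_minus_left add.inverse_inverse)
        then show ?thesis using \<zeta> by (simp add: dot_square_norm)
      qed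
      with \<tau>_expand[OF \<zeta> cb(2)] small(1)[OF d(3,4)]
      have t: "d / 2 \<le> \<tau> \<zeta> \<bullet> (f x - G \<zeta>)" by (simp add: nd \<eta> abs_le_iff)
      have "norm (f x - G \<zeta>) \<le> norm (DG \<zeta> (\<eta> - \<zeta>)) + CG * d powr \<beta>"
        using taylor[OF cb] norm_triangle_sub[of "G \<eta> - G \<zeta>" "DG \<zeta> (\<eta> - \<zeta>)"] by (simp add: nd \<eta>)
      also have "\<dots> \<le> MG * d + CG * d"
        using DGle[OF cb(1), of "\<eta> - \<zeta>"] small(2)[OF d(3,4)] CG by (intro add_mono mult_left_mono) (auto simp: nd)
      finally have p: "norm (f x - G \<zeta>) \<le> (MG + CG) * d" by (simp add: distrib_right)
      have MC: "MG + CG > 0" using MG CG by simp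
      have "\<eta> \<noteq> \<zeta>" using nd d by auto
      then have "f x \<noteq> G \<zeta>" using \<eta> GH(1)[OF cb(1)] GH(1)[OF cb(2)] by metis
      moreover have "norm (f x - G \<zeta>) < r0"
      proof -
        have "(MG + CG) * d \<le> (MG + CG) * (r0 / (2 * (MG + CG)))"
          using d \<epsilon> MC by (intro mult_left_mono) auto
        also have "\<dots> = r0 / 2" using MC by (simp add: field_simps)
        finally show ?thesis using p r0 by simp
      qed
      moreover have "c * norm (f x - G \<zeta>) \<le> d / 2"
      proof -
        have "c * norm (f x - G \<zeta>) \<le> c * ((MG + CG) * d)" using p pos by (intro mult_left_mono) auto
        also have "\<dots> = (c * (MG + CG)) * d" by (simp only: mult.assoc)
        also have "c * (MG + CG) = 1 / 2" using MC by (simp add: c_def field_simps)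
        finally show ?thesis by simp
      qed
      ultimately show ?thesis using \<zeta> t by (intro bexI[of _ \<zeta>] conjI) auto
    qed
    show "y \<in> G ` sphere 0 1"
      if "(x, y) \<in> closure ((\<lambda>x. (x, f x)) ` ball 0 1)" "norm x = 1" for x y
    proof -
      have y: "y \<in> closure \<Omega>" "y \<notin> \<Omega>" using closure_graph_at_sphere[OF hom_f open_\<Omega> that] by auto
      \<comment> \<open>\<open>G\<close> maps the open ball onto \<open>\<Omega>\<close>, so a point
        of the closure off \<open>\<Omega>\<close> has its parameter on the sphere.\<close>
      have "G (H y) \<notin> G ` ball 0 1" using y HG(1)[OF y(1)] by (simp only: G\<Omega> not_False_eq_True)
      then have "H y \<notin> ball 0 1" by (metis imageI)
      then have "H y \<in> sphere 0 1" using HG(2)[OF y(1)] by simp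
      then show ?thesis using HG(1)[OF y(1)] by (metis imageI)
    qed
    show "bounded (f ` ball 0 1)"
      unfolding assms(7) by (rule bounded_subset[OF compact_imp_bounded[OF compact_\<Omega>] closure_subset])
    show "\<tau> \<zeta> \<bullet> (G \<xi> - G \<zeta>) \<le> C0 * norm (G \<xi> - G \<zeta>) powr \<beta>"
      if "\<zeta> \<in> sphere 0 1" "\<xi> \<in> sphere 0 1" "norm (G \<xi> - G \<zeta>) \<le> r0" for \<zeta> \<xi>
      using bdry[OF that(1,2)] that(3) r0 by simp
    show "continuous_on (sphere 0 1) G" by (rule continuous_on_subset[OF Gc sub])
    show "c1 \<le> norm (\<tau> \<zeta>)" if "\<zeta> \<in> sphere 0 1" for \<zeta> unfolding c1_def by (rule \<tau>_lower[OF that])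
  qed (use \<beta> \<tau>c pos MH \<tau>_upper C0 A r0 \<rho>1 in \<open>auto simp: C_def\<close>)
  show ?thesis by (rule lipschitz_on_ball)
qed

end
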